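(* Let $\mathcal B$ be a Baer subplane of $\mathrm{PG}(2,q^2)$ tangent to $\ell_\infty$ at the point $\bar T=\mathcal B\cap\ell_\infty$, and let $\bar P\in\ell_\infty$, $\bar P\neq\bar T$. Every $\ell_\infty$-Baer pencil with vertex $\bar P$ meets $\mathcal B$ either (i) in a non-degenerate conic of $\mathcal B$ through $\bar T$, or (ii) in the union of two lines of $\mathcal B$, namely the unique line of $\mathcal B$ whose extension to a line of $\mathrm{PG}(2,q^2)$ contains $\bar P$, and one line of $\mathcal B$ through $\bar T$. Among the $\ell_\infty$-Baer pencils with vertex $\bar P$, exactly $q^2-1$ are of type (i) and exactly $q+1$ are of type (ii), the latter containing respectively the $q+1$ distinct lines of $\mathcal B$ through $\bar T$.
   Context: A Baer subplane of $\mathrm{PG}(2,q^2)$ is a subplane of order $q$; it is tangent to $\ell_\infty$ if it meets $\ell_\infty$ in exactly one point. A line of $\mathcal B$ means a Baer subline $m\cap\mathcal B$ with $|m\cap\mathcal B|=q+1$. A Baer pencil in $\mathrm{PG}(2,q^2)$ is the union of the $q+1$ lines joining a vertex point $P$ to the points of a Baer subline $b$ (the base) not through $P$. An $\ell_\infty$-Baer pencil is a Baer pencil whose vertex lies on $\ell_\infty$ and whose base meets $\ell_\infty$ in a point; it contains $\ell_\infty$ and $q^3$ affine points. *)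

theory Defs
  imports Main
begin

type_synonym 'a vec3 = "'a \<times> 'a \<times> 'a"

definition smul :: "'a::field \<Rightarrow> 'a vec3 \<Rightarrow> 'a vec3" where
  "smul c v = (case v of (x,y,z) \<Rightarrow> (c*x, c*y, c*z))"

definition vadd :: "'a::field vec3 \<Rightarrow> 'a vec3 \<Rightarrow> 'a vec3" where
  "vadd v w = (case v of (x,y,z) \<Rightarrow> (case w of (x',y',z') \<Rightarrow> (x+x', y+y', z+z')))"

definition dot3 :: "'a::field vec3 \<Rightarrow> 'a vec3 \<Rightarrow> 'a" where
  "dot3 v w = (case v of (x,y,z) \<Rightarrow> (case w of (x',y',z') \<Rightarrow> x*x' + y*y' + z*z'))"

definition det3 :: "'a::field vec3 \<Rightarrow> 'a vec3 \<Rightarrow> 'a vec3 \<Rightarrow> 'a" where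
  "det3 u v w = (case u of (a,b,c) \<Rightarrow> case v of (d,e,f) \<Rightarrow> case w of (g,h,i) \<Rightarrow>
      a*(e*i - f*h) - b*(d*i - f*g) + c*(d*h - e*g))"

definition pt :: "'a::field vec3 \<Rightarrow> 'a vec3 set" where
  "pt v = range (\<lambda>c. smul c v)"

definition pg_points :: "'a::field vec3 set set" where
  "pg_points = {pt v | v. v \<noteq> (0,0,0)}"

definition line_of :: "'a::field vec3 \<Rightarrow> 'a vec3 set set" where
  "line_of n = {P \<in> pg_points. \<forall>v\<in>P. dot3 n v = 0}"

definition pg_lines :: "'a::field vec3 set set set" where
  "pg_lines = {line_of n | n. n \<noteq> (0,0,0)}"

definition join :: "'a::field vec3 set \<Rightarrow> 'a vec3 set \<Rightarrow> 'a vec3 set set" where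
  "join P X = (THE l. l \<in> pg_lines \<and> P \<in> l \<and> X \<in> l)"

definition subq :: "nat \<Rightarrow> 'a::field set" where
  "subq q = {x. x ^ q = x}"

text \<open>Subplane of order q of PG(2,F): a set of points closed under the induced
  incidence structure (lines meeting it in at least two points), containing a
  quadrangle, all of whose lines have q+1 points.\<close>
definition baer_subplane :: "nat \<Rightarrow> 'a::field vec3 set set \<Rightarrow> bool" where
  "baer_subplane q B \<longleftrightarrow> B \<subseteq> pg_points
     \<and> (\<forall>l\<in>pg_lines. card (l \<inter> B) \<ge> 2 \<longrightarrow> card (l \<inter> B) = q + 1)
     \<and> (\<forall>l\<in>pg_lines. \<forall>m\<in>pg_lines. l \<noteq> m \<and> card (l \<inter> B) \<ge> 2 \<and> card (m \<inter> B) \<ge> 2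
            \<longrightarrow> l \<inter> m \<subseteq> B)
     \<and> (\<exists>Q. Q \<subseteq> B \<and> card Q = 4 \<and> (\<forall>l\<in>pg_lines. card (l \<inter> Q) \<le> 2))"

definition b_line :: "nat \<Rightarrow> 'a::field vec3 set set \<Rightarrow> 'a vec3 set set \<Rightarrow> bool" where
  "b_line q B L \<longleftrightarrow> (\<exists>m\<in>pg_lines. L = m \<inter> B \<and> card L = q + 1)"

text \<open>Baer subline of PG(2,q^2): image of PG(1,q) in the line spanned by u, w.\<close>
definition baer_subline :: "nat \<Rightarrow> 'a::field vec3 set set \<Rightarrow> bool" where
  "baer_subline q b \<longleftrightarrow> (\<exists>u w. u \<noteq> (0,0,0) \<and> w \<noteq> (0,0,0) \<and> pt u \<noteq> pt w \<and>
     b = {pt (vadd (smul s u) (smul t w)) | s t. s \<in> subq q \<and> t \<in> subq q \<and> (s,t) \<noteq> (0,0)})"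

definition baer_pencil :: "nat \<Rightarrow> 'a::field vec3 set \<Rightarrow> 'a vec3 set set \<Rightarrow> 'a vec3 set set \<Rightarrow> bool" where
  "baer_pencil q P b \<Pi> \<longleftrightarrow> P \<in> pg_points \<and> baer_subline q b
     \<and> (\<forall>m\<in>pg_lines. b \<subseteq> m \<longrightarrow> P \<notin> m) \<and> \<Pi> = \<Union> (join P ` b)"

definition linf_baer_pencil ::
  "nat \<Rightarrow> 'a::field vec3 set set \<Rightarrow> 'a vec3 set \<Rightarrow> 'a vec3 set set \<Rightarrow> bool" where
  "linf_baer_pencil q linf P \<Pi> \<longleftrightarrow> P \<in> linf \<and>
     (\<exists>b. baer_pencil q P b \<Pi> \<and> card (b \<inter> linf) = 1)"

text \<open>Non-degenerate conic of the Baer subplane B: in some coordinatisation of B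
  as PG(2,q) (coordinates in GF(q) w.r.t. a basis u,v,w), the conic X Z = Y^2.\<close>
definition nondeg_conic_of :: "nat \<Rightarrow> 'a::field vec3 set set \<Rightarrow> 'a vec3 set set \<Rightarrow> bool" where
  "nondeg_conic_of q B C \<longleftrightarrow> (\<exists>u v w. det3 u v w \<noteq> 0 \<and>
     B = {pt (vadd (smul s u) (vadd (smul t v) (smul r w))) | s t r.
            s \<in> subq q \<and> t \<in> subq q \<and> r \<in> subq q \<and> (s,t,r) \<noteq> (0,0,0)} \<and>
     C = {pt (vadd (smul s u) (vadd (smul t v) (smul r w))) | s t r.
            s \<in> subq q \<and> t \<in> subq q \<and> r \<in> subq q \<and> (s,t,r) \<noteq> (0,0,0) \<and> s * r = t ^ 2})"

end

theory Submission
  imports Defs "HOL-Computational_Algebra.Polynomial"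
begin

text \<open>
  Von Staudt's constructions show that the affine coordinates of the points of \<open>B\<close> on an axis of
  a quadrangle of \<open>B\<close> form a set \<open>S\<close> of \<open>q\<close> elements closed under sums and products, so
  \<open>S\<close> is the field \<open>K = GF(q)\<close> of roots of \<open>x\<^sup>q = x\<close>, and \<open>B\<close> is the set of points with
  coordinates in \<open>K\<close>. Choose a \<open>K\<close>-basis \<open>u, v, w\<close> of \<open>B\<close> with \<open>T = \<langle>u\<rangle>\<close> and
  \<open>P = \<langle>w - \<theta>v\<rangle>\<close>, and covectors \<open>X, E\<close> vanishing on \<open>P\<close> such that \<open>E = 0\<close> is the line at
  infinity, \<open>E v = 1\<close>, \<open>E w = \<theta>\<close>, \<open>X u = 1\<close> and \<open>X\<close> vanishes on \<open>v, w\<close>. Then \<open>(X, E)\<close> maps \<open>B\<close> onto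
  the pairs \<open>(x, \<eta>) \<noteq> (0, 0)\<close> with \<open>x \<in> K\<close> and \<open>\<eta>\<close> in the big field, modulo scalars.

  A pencil with vertex \<open>P\<close> is given by the condition \<open>X / E \<in> l\<close> (or \<open>E = 0\<close>) for an affine
  \<open>K\<close>-line \<open>l\<close> of the big field. Lines through 0 have the form \<open>gK\<close>; there are \<open>q + 1\<close> of them, and
  \<open>x / \<eta> \<in> gK\<close> means \<open>x = 0\<close> or \<open>\<eta> \<in> g\<^sup>-\<^sup>1K\<close>, a pair of lines. The other lines are
  \<open>g(K + \<theta>)\<close> for a unique \<open>g \<noteq> 0\<close>; there are \<open>q\<^sup>2 - 1\<close> of them, and \<open>x / \<eta> \<in> g(K + \<theta>)\<close> becomes a
  conic equation in \<open>K\<close>-coordinates.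
\<close>

section \<open>Homogeneous coordinates\<close>

lemma smul_triple [simp]: "smul c (x, y, z) = (c * x, c * y, c * z)"
  by (simp add: smul_def)

lemma vadd_triple [simp]: "vadd (x, y, z) (x', y', z') = (x + x', y + y', z + z')"
  by (simp add: vadd_def)

lemma dot3_triple [simp]: "dot3 (x, y, z) (x', y', z') = x * x' + y * y' + z * z'"
  by (simp add: dot3_def)

lemma det3_triple [simp]:
  "det3 (a, b, c) (d, e, f) (g, h, i) = a*(e*i - f*h) - b*(d*i - f*g) + c*(d*h - e*g)"
  by (simp add: det3_def)

text \<open>The cross product doubles as the covector of the line joining two points, since pairing
  \<open>cross3 u v\<close> with a third vector gives the determinant.\<close>

definition cross3 :: "'a::field vec3 \<Rightarrow> 'a vec3 \<Rightarrow> 'a vec3" where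
  "cross3 v w = (case v of (x, y, z) \<Rightarrow> case w of (x', y', z') \<Rightarrow>
     (y * z' - z * y', z * x' - x * z', x * y' - y * x'))"

lemma cross3_triple [simp]:
  "cross3 (x, y, z) (x', y', z') = (y * z' - z * y', z * x' - x * z', x * y' - y * x')"
  by (simp add: cross3_def)

abbreviation lc :: "'a::field vec3 \<Rightarrow> 'a vec3 \<Rightarrow> 'a vec3 \<Rightarrow> 'a \<Rightarrow> 'a \<Rightarrow> 'a \<Rightarrow> 'a vec3" where
  "lc u v w x y z \<equiv> vadd (smul x u) (vadd (smul y v) (smul z w))"

lemma dot3_vadd [simp]: "dot3 n (vadd v w) = dot3 n v + dot3 n w"
  by (cases n; cases v; cases w) (simp add: algebra_simps)

lemma dot3_smul [simp]: "dot3 n (smul c v) = c * dot3 n v"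
  by (cases n; cases v) (simp add: algebra_simps)

lemma dot3_smul_left [simp]: "dot3 (smul c n) v = c * dot3 n v"
  by (cases n; cases v) (simp add: algebra_simps)

lemma dot3_vadd_left [simp]: "dot3 (vadd n m) v = dot3 n v + dot3 m v"
  by (cases n; cases v; cases m) (simp add: algebra_simps)

lemma dot3_zero [simp]: "dot3 n (0, 0, 0) = 0"
  by (cases n) simp

lemma dot3_zero_left [simp]: "dot3 (0, 0, 0) v = 0"
  by (cases v) simp

lemma smul_smul [simp]: "smul c (smul d v) = smul (c * d) v"
  by (cases v) (simp add: algebra_simps)

lemma smul_one [simp]: "smul 1 v = v"
  by (cases v) simp

lemma smul_zero [simp]: "smul 0 v = (0, 0, 0)"
  by (cases v) simp

lemma smul_eq_zero_iff [simp]: "smul c v = (0, 0, 0) \<longleftrightarrow> c = 0 \<or> v = (0, 0, 0)"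
  by (cases v) auto

lemma dot3_cross3: "dot3 (cross3 u v) w = det3 u v w"
  by (cases u; cases v; cases w) (simp add: algebra_simps)

lemma det3_same [simp]: "det3 u v u = 0" "det3 u v v = 0" "det3 u u v = 0"
  by (cases u; cases v; simp add: algebra_simps)+

text \<open>Multiplicativity of the determinant. It lets collinearity be tested on coordinate
  triples relative to any basis \<open>u\<close>, \<open>v\<close>, \<open>w\<close>.\<close>

lemma det3_lc:
  "det3 (lc u v w a b c) (lc u v w d e f) (lc u v w g h i) = det3 (a, b, c) (d, e, f) (g, h, i) * det3 u v w"
  by (induct u rule: prod_induct3; induct v rule: prod_induct3; induct w rule: prod_induct3; simp add: algebra_simps)

lemma smul_lc: "smul c (lc u v w x y z) = lc u v w (c * x) (c * y) (c * z)"
  by (cases u; cases v; cases w) (simp add: algebra_simps)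

lemma lc_eq_zero_iff:
  assumes "det3 u v w \<noteq> 0"
  shows "lc u v w x y z = (0, 0, 0) \<longleftrightarrow> x = 0 \<and> y = 0 \<and> z = 0"
proof
  assume *: "lc u v w x y z = (0, 0, 0)"
  \<comment> \<open>Cramer's rule: up to the factor \<open>det3 u v w\<close>, the three cross
    products form the dual basis.\<close>
  have "x * det3 u v w = dot3 (cross3 v w) (lc u v w x y z)"
       "y * det3 u v w = dot3 (cross3 w u) (lc u v w x y z)"
       "z * det3 u v w = dot3 (cross3 u v) (lc u v w x y z)"
    by (induct u rule: prod_induct3; induct v rule: prod_induct3; induct w rule: prod_induct3; simp add: algebra_simps)+
  then show "x = 0 \<and> y = 0 \<and> z = 0"
    unfolding * using assms by simp
qed (cases u; cases v; cases w; simp)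

lemma lc_eq_iff:
  assumes "det3 u v w \<noteq> 0"
  shows "lc u v w x y z = lc u v w x' y' z' \<longleftrightarrow> x = x' \<and> y = y' \<and> z = z'"
proof -
  have "lc u v w x y z = lc u v w x' y' z' \<longleftrightarrow> lc u v w (x - x') (y - y') (z - z') = (0, 0, 0)"
    by (cases u; cases v; cases w) (auto simp: algebra_simps)
  then show ?thesis
    by (simp only: lc_eq_zero_iff [OF assms]) auto
qed

lemma lc_surj:
  assumes "det3 u v w \<noteq> 0"
  obtains x y z where "r = lc u v w x y z"
proof
  have "smul (det3 u v w) r = lc u v w (dot3 (cross3 v w) r) (dot3 (cross3 w u) r) (dot3 (cross3 u v) r)"
    by (induct u rule: prod_induct3; induct v rule: prod_induct3; induct w rule: prod_induct3;
        induct r rule: prod_induct3; simp add: algebra_simps)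
  then have "smul (1 / det3 u v w) (smul (det3 u v w) r)
      = smul (1 / det3 u v w) (lc u v w (dot3 (cross3 v w) r) (dot3 (cross3 w u) r) (dot3 (cross3 u v) r))"
    by simp
  then show "r = lc u v w (1 / det3 u v w * dot3 (cross3 v w) r) (1 / det3 u v w * dot3 (cross3 w u) r)
      (1 / det3 u v w * dot3 (cross3 u v) r)"
    using assms unfolding smul_lc by simp
qed

lemma covector_eq_zero:
  assumes "det3 u v w \<noteq> 0" "dot3 n u = 0" "dot3 n v = 0" "dot3 n w = 0"
  shows "n = (0, 0, 0)"
proof -
  have z: "dot3 n r = 0" for r
    by (rule lc_surj [OF assms(1), of r]) (simp add: assms)
  show ?thesis
    using z[of "(1,0,0)"] z[of "(0,1,0)"] z[of "(0,0,1)"] by (cases n) simp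
qed

lemma pt_in_pg_points: "v \<noteq> (0, 0, 0) \<Longrightarrow> pt v \<in> pg_points"
  unfolding pg_points_def by blast

lemma pg_pointsE:
  assumes "P \<in> pg_points"
  obtains v where "v \<noteq> (0, 0, 0)" "P = pt v"
  using assms unfolding pg_points_def by blast

lemma pt_smul [simp]:
  assumes "c \<noteq> 0"
  shows "pt (smul c v) = pt v"
proof -
  have "range (\<lambda>d. smul (d * c) v) = range (\<lambda>d. smul d v)"
  proof
    show "range (\<lambda>d. smul d v) \<subseteq> range (\<lambda>d. smul (d * c) v)"
      using assms by (intro image_subsetI, rule_tac x = "x / c" in range_eqI) simp
  qed blast
  then show ?thesis
    by (simp add: pt_def)
qed

lemma pt_eq_pt_iff:
  assumes "v \<noteq> (0, 0, 0)" "w \<noteq> (0, 0, 0)"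
  shows "pt v = pt w \<longleftrightarrow> (\<exists>c. c \<noteq> 0 \<and> w = smul c v)"
proof
  assume "pt v = pt w"
  moreover have "w \<in> pt w"
    unfolding pt_def by (rule range_eqI [of _ _ 1]) simp
  ultimately obtain c where "w = smul c v"
    by (auto simp: pt_def)
  then show "\<exists>c. c \<noteq> 0 \<and> w = smul c v"
    using assms by auto
qed auto

lemma cross3_eq_zero_iff:
  assumes "v \<noteq> (0, 0, 0)" "w \<noteq> (0, 0, 0)"
  shows "cross3 v w = (0, 0, 0) \<longleftrightarrow> pt v = pt w"
proof -
  obtain a b c where v: "v = (a, b, c)" by (cases v)
  obtain d e f where w: "w = (d, e, f)" by (cases w)
  have "\<exists>k. k \<noteq> 0 \<and> w = smul k v" if *: "cross3 v w = (0, 0, 0)"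
  proof -
    have "\<exists>k. w = smul k v"
    proof -
      consider "a \<noteq> 0" | "b \<noteq> 0" | "c \<noteq> 0" using assms v by auto
      then show ?thesis
      proof cases
        case 1 then show ?thesis using * v w by (intro exI[of _ "d / a"]) (simp add: field_simps)
      next
        case 2 then show ?thesis using * v w by (intro exI[of _ "e / b"]) (simp add: field_simps)
      next
        case 3 then show ?thesis using * v w by (intro exI[of _ "f / c"]) (simp add: field_simps)
      qed
    qed
    then show ?thesis using assms by auto
  qed
  moreover have "cross3 v (smul k v) = (0, 0, 0)" for k
    by (cases v) simp
  ultimately show ?thesis
    by (auto simp: pt_eq_pt_iff[OF assms])
qed

lemma pt_in_line_of [simp]: "v \<noteq> (0, 0, 0) \<Longrightarrow> pt v \<in> line_of n \<longleftrightarrow> dot3 n v = 0"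
proof -
  assume v: "v \<noteq> (0, 0, 0)"
  have "v \<in> pt v" unfolding pt_def by (rule range_eqI [of _ _ 1]) simp
  then show ?thesis
    using pt_in_pg_points[OF v] by (auto simp: line_of_def pt_def)
qed

lemma line_of_subset: "line_of n \<subseteq> pg_points"
  by (auto simp: line_of_def)

lemma line_of_smul [simp]: "c \<noteq> 0 \<Longrightarrow> line_of (smul c n) = line_of n"
  by (auto simp: line_of_def)

lemma line_of_in_pg_lines: "n \<noteq> (0, 0, 0) \<Longrightarrow> line_of n \<in> pg_lines"
  unfolding pg_lines_def by blast

lemma pg_linesE:
  assumes "l \<in> pg_lines"
  obtains n where "n \<noteq> (0, 0, 0)" "l = line_of n"
  using assms unfolding pg_lines_def by blast

lemma line_of_two_points:
  assumes "n \<noteq> (0, 0, 0)" "dot3 n u = 0" "dot3 n v = 0" "cross3 u v \<noteq> (0, 0, 0)"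
  shows "line_of n = line_of (cross3 u v)"
proof -
  \<comment> \<open>The double cross product identity; both coefficients vanish, so \<open>n\<close>
    is proportional to \<open>cross3 u v\<close>.\<close>
  have "cross3 n (cross3 u v) = vadd (smul (dot3 n v) u) (smul (- dot3 n u) v)"
    by (cases n; cases u; cases v) (simp add: algebra_simps)
  also have "\<dots> = (0, 0, 0)"
    using assms by (cases u; cases v) simp
  finally have "pt n = pt (cross3 u v)"
    using cross3_eq_zero_iff assms by blast
  then obtain c where "c \<noteq> 0" "cross3 u v = smul c n"
    using pt_eq_pt_iff assms by blast
  then show ?thesis by simp
qed

lemma pg_lines_eqI:
  assumes "l \<in> pg_lines" "m \<in> pg_lines" "X \<in> l" "Y \<in> l" "X \<in> m" "Y \<in> m" "X \<noteq> Y"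
  shows "l = m"
proof -
  obtain n where n: "n \<noteq> (0, 0, 0)" "l = line_of n" using assms(1) by (rule pg_linesE)
  obtain k where k: "k \<noteq> (0, 0, 0)" "m = line_of k" using assms(2) by (rule pg_linesE)
  obtain x where x: "x \<noteq> (0, 0, 0)" "X = pt x" using assms n line_of_subset pg_pointsE by blast
  obtain y where y: "y \<noteq> (0, 0, 0)" "Y = pt y" using assms n line_of_subset pg_pointsE by blast
  have "cross3 x y \<noteq> (0, 0, 0)" using assms x y cross3_eq_zero_iff by blast
  moreover have "dot3 n x = 0" "dot3 n y = 0" "dot3 k x = 0" "dot3 k y = 0"
    using assms x y n k by simp_all
  ultimately have "line_of n = line_of (cross3 x y)" "line_of k = line_of (cross3 x y)"
    using line_of_two_points n k by blast+
  then show ?thesis using n k by simp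
qed

lemma join_eqI:
  assumes "l \<in> pg_lines" "P \<in> l" "X \<in> l" "P \<noteq> X"
  shows "join P X = l"
  unfolding join_def using assms pg_lines_eqI by (intro the_equality) blast+

lemma card_ge_2I: "finite A \<Longrightarrow> x \<in> A \<Longrightarrow> y \<in> A \<Longrightarrow> x \<noteq> y \<Longrightarrow> card A \<ge> 2"
  using card_mono[of A "{x, y}"] by auto

lemma card_ge_2E:
  assumes "card A \<ge> 2"
  obtains x y where "x \<in> A" "y \<in> A" "x \<noteq> y"
proof -
  have "\<not> A \<subseteq> {x}" for x
    using assms card_mono[of "{x}" A] by auto
  then obtain x where "x \<in> A" by auto
  then show ?thesis using \<open>\<not> A \<subseteq> {x}\<close> that by auto
qed

section \<open>Coordinatizing a Baer subplane\<close>

lemma cross3_nonzeroD: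
  assumes "cross3 c d \<noteq> (0, 0, 0)"
  shows "c \<noteq> (0, 0, 0)" "d \<noteq> (0, 0, 0)" "pt c \<noteq> pt d"
proof -
  show *: "c \<noteq> (0, 0, 0)" "d \<noteq> (0, 0, 0)"
    using assms by (cases c; cases d; auto)+
  show "pt c \<noteq> pt d"
    using assms cross3_eq_zero_iff[OF *] by simp
qed

lemma det3_nonzeroD:
  assumes "det3 a b c \<noteq> 0"
  shows "cross3 a b \<noteq> (0, 0, 0)" "c \<noteq> (0, 0, 0)"
  using assms dot3_cross3[of a b c] by (cases c; fastforce)+

text \<open>The closure axiom in determinant form: two secant lines of \<open>B\<close> meet in a
  point of \<open>B\<close>. The hypothesis on \<open>det3 a b c\<close> puts \<open>c\<close> off
  the line \<open>ab\<close>, so the two lines are distinct.\<close>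

lemma baer_subplane_meet:
  fixes B :: "('a::{field,finite}) vec3 set set"
  assumes B: "baer_subplane q B"
    and mem: "pt a \<in> B" "pt b \<in> B" "pt c \<in> B" "pt d \<in> B"
    and abc: "det3 a b c \<noteq> 0" and cd: "cross3 c d \<noteq> (0, 0, 0)"
    and r: "r \<noteq> (0, 0, 0)" "det3 a b r = 0" "det3 c d r = 0"
  shows "pt r \<in> B"
proof -
  let ?l = "line_of (cross3 a b)" and ?m = "line_of (cross3 c d)"
  note ab = det3_nonzeroD(1)[OF abc]
  note nz = cross3_nonzeroD[OF ab] cross3_nonzeroD[OF cd]
  have "pt a \<in> ?l \<inter> B" "pt b \<in> ?l \<inter> B" "pt c \<in> ?m \<inter> B" "pt d \<in> ?m \<inter> B"
    using mem nz by (simp_all add: dot3_cross3)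
  then have "card (?l \<inter> B) \<ge> 2" "card (?m \<inter> B) \<ge> 2"
    using nz by (blast intro: card_ge_2I[OF finite])+
  moreover have "pt c \<in> ?m" "pt c \<notin> ?l"
    using nz abc by (simp_all add: dot3_cross3)
  then have "?l \<noteq> ?m" by blast
  moreover have "?l \<in> pg_lines" "?m \<in> pg_lines"
    using ab cd by (simp_all add: line_of_in_pg_lines)
  ultimately have "?l \<inter> ?m \<subseteq> B"
    using B unfolding baer_subplane_def by blast
  then show ?thesis
    using r by (auto simp: dot3_cross3)
qed

section \<open>Von Staudt constructions in a Baer subplane\<close>

locale coord_subplane =
  fixes q :: nat and B :: "('a::{field,finite}) vec3 set set" and u v w :: "'a vec3"
  assumes subplane: "baer_subplane q B"
    and indep: "det3 u v w \<noteq> 0"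
    and quadrangle: "pt u \<in> B" "pt v \<in> B" "pt w \<in> B" "pt (lc u v w 1 1 1) \<in> B"
    and card_field: "card (UNIV :: 'a set) = q ^ 2"
begin

text \<open>The coordinates form a single triple, so that \<open>det3\<close> and
  \<open>cross3\<close> apply directly to the arguments of \<open>C\<close>.\<close>

definition C :: "'a vec3 \<Rightarrow> bool" where
  "C t = (case t of (x, y, z) \<Rightarrow> pt (lc u v w x y z) \<in> B)"

text \<open>Here \<open>(0, 0, 1)\<close> is the origin of the first axis and
  \<open>(1, 0, 0)\<close> its point at infinity, so \<open>S\<close> collects the abscissas of the
  affine points of \<open>B\<close> on that axis.\<close>

definition S :: "'a set" where "S = {x. C (x, 0, 1)}"

lemma C_smul: "k \<noteq> 0 \<Longrightarrow> C (k * x, k * y, k * z) \<longleftrightarrow> C (x, y, z)"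
  unfolding C_def prod.case smul_lc[symmetric] by (simp del: smul_smul)

text \<open>The coordinate map multiplies determinants by the nonzero constant
  \<open>det3 u v w\<close>, so \<open>baer_subplane_meet\<close> carries over to triples. Each
  construction step below is one application: the lines \<open>ab\<close> and \<open>cd\<close> meet
  in \<open>r\<close>.\<close>

lemma C_meet:
  assumes "C a" "C b" "C c" "C d" "det3 a b c \<noteq> 0" "cross3 c d \<noteq> (0, 0, 0)"
    "r \<noteq> (0, 0, 0)" "det3 a b r = 0" "det3 c d r = 0"
  shows "C r"
proof -
  define f where "f t = (case t of (x, y, z) \<Rightarrow> lc u v w x y z)" for t
  have C: "C t \<longleftrightarrow> pt (f t) \<in> B" for t
    by (simp add: C_def f_def split: prod.split)
  have f0: "f t \<noteq> (0, 0, 0)" if "t \<noteq> (0, 0, 0)" for t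
    using that lc_eq_zero_iff[OF indep] by (cases t) (auto simp: f_def)
  have det: "det3 (f s) (f t) (f t') = det3 s t t' * det3 u v w" for s t t'
    by (cases s; cases t; cases t') (simp only: f_def prod.case det3_lc)
  have cross: "cross3 (f c) (f d) \<noteq> (0, 0, 0)"
  proof
    note nz = cross3_nonzeroD[OF assms(6)]
    assume "cross3 (f c) (f d) = (0, 0, 0)"
    then have "pt (f c) = pt (f d)" using cross3_eq_zero_iff f0 nz by blast
    then obtain k where k: "k \<noteq> 0" "f d = smul k (f c)" using pt_eq_pt_iff f0 nz by blast
    have "smul k (f c) = f (smul k c)"
      by (cases c) (simp add: f_def smul_lc del: smul_smul)
    then have "d = smul k c"
      using k lc_eq_iff[OF indep] by (cases c; cases d) (auto simp: f_def)
    then show False using k nz by simp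
  qed
  show ?thesis
    unfolding C
    by (rule baer_subplane_meet[OF subplane, of "f a" "f b" "f c" "f d"])
      (use assms cross f0 indep in \<open>simp_all add: C det\<close>)
qed

lemma C_quad: "C (1, 0, 0)" "C (0, 1, 0)" "C (0, 0, 1)" "C (1, 1, 1)"
proof -
  have "lc u v w 1 0 0 = u" "lc u v w 0 1 0 = v" "lc u v w 0 0 1 = w"
    by (cases u; cases v; cases w; simp)+
  then show "C (1, 0, 0)" "C (0, 1, 0)" "C (0, 0, 1)" "C (1, 1, 1)"
    using quadrangle by (simp_all add: C_def)
qed

lemma C_110: "C (1, 1, 0)"
  by (rule C_meet[of "(1,0,0)" "(0,1,0)" "(0,0,1)" "(1,1,1)"]) (simp_all add: C_quad)

lemma zero_in_S: "0 \<in> S" by (simp add: S_def C_quad)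

lemma one_in_S: "1 \<in> S"
  unfolding S_def mem_Collect_eq
  by (rule C_meet[of "(1,0,0)" "(0,0,1)" "(0,1,0)" "(1,1,1)"]) (simp_all add: C_quad)

text \<open>The vertical line through \<open>(x, 0, 1)\<close> meets the diagonal through the origin
  and the unit point. This and the next lemmas move coordinates between the two axes along vertical
  lines, horizontal lines and the diagonal, so both axes carry the same set
  \<open>S\<close>.\<close>

lemma C_diag_if_x: "C (x, 0, 1) \<Longrightarrow> C (x, x, 1)"
  by (rule C_meet[of "(0,0,1)" "(1,1,1)" "(0,1,0)" "(x,0,1)"]) (simp_all add: C_quad)

lemma C_y_if_diag: "C (x, x, 1) \<Longrightarrow> C (0, x, 1)"
  by (rule C_meet[of "(0,1,0)" "(0,0,1)" "(1,0,0)" "(x,x,1)"]) (simp_all add: C_quad)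

lemma C_diag_if_y: "C (0, x, 1) \<Longrightarrow> C (x, x, 1)"
  by (rule C_meet[of "(0,0,1)" "(1,1,1)" "(1,0,0)" "(0,x,1)"]) (simp_all add: C_quad)

lemma C_x_if_affine: "C (x, y, 1) \<Longrightarrow> C (x, 0, 1)"
  by (rule C_meet[of "(1,0,0)" "(0,0,1)" "(0,1,0)" "(x,y,1)"]) (simp_all add: C_quad)

lemma C_y_if_affine: "C (x, y, 1) \<Longrightarrow> C (0, y, 1)"
  by (rule C_meet[of "(0,1,0)" "(0,0,1)" "(1,0,0)" "(x,y,1)"]) (simp_all add: C_quad)

lemma C_affine_if: "C (x, 0, 1) \<Longrightarrow> C (0, y, 1) \<Longrightarrow> C (x, y, 1)"
  by (rule C_meet[of "(0,1,0)" "(x,0,1)" "(1,0,0)" "(0,y,1)"]) (simp_all add: C_quad)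

lemma C_y_iff: "C (0, y, 1) \<longleftrightarrow> y \<in> S"
  using C_x_if_affine[OF C_diag_if_y, of y] C_y_if_diag[OF C_diag_if_x, of y] by (auto simp: S_def)

lemma C_affine_iff: "C (x, y, 1) \<longleftrightarrow> x \<in> S \<and> y \<in> S"
proof
  assume "C (x, y, 1)"
  then have "C (x, 0, 1)" "C (0, y, 1)"
    by (fact C_x_if_affine, fact C_y_if_affine)
  then show "x \<in> S \<and> y \<in> S"
    by (simp add: C_y_iff) (simp add: S_def)
next
  assume "x \<in> S \<and> y \<in> S"
  then have "C (x, 0, 1)" "C (0, y, 1)"
    by (simp_all add: C_y_iff) (simp add: S_def)
  then show "C (x, y, 1)"
    by (rule C_affine_if)
qed

lemma S_add:
  assumes "a \<in> S" "b \<in> S" shows "a + b \<in> S"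
proof -
  have "C (0, b, 1)" "C (a, 0, 1)" using assms zero_in_S by (simp_all add: C_affine_iff)
  \<comment> \<open>The vertical line with abscissa \<open>a\<close> meets the line of slope 1
    through \<open>(0, b, 1)\<close>; the direction of slope 1 is \<open>(1, 1, 0)\<close>.\<close>
  then have "C (a, a + b, 1)"
    by - (rule C_meet[of "(0,1,0)" "(a,0,1)" "(1,1,0)" "(0,b,1)"], simp_all add: C_quad C_110)
  then show ?thesis by (simp add: C_affine_iff)
qed

lemma S_mult:
  assumes "a \<in> S" "b \<in> S" shows "a * b \<in> S"
proof (cases "a = 0")
  case False
  have "C (1, b, 1)" "C (a, 0, 1)" using assms zero_in_S one_in_S by (simp_all add: C_affine_iff)
  \<comment> \<open>The vertical line with abscissa \<open>a\<close> meets the line from the origin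
    through \<open>(1, b, 1)\<close>. For \<open>a = 0\<close> the vertical line passes through the
    origin, and \<open>C_meet\<close> does not apply.\<close>
  then have "C (a, a * b, 1)"
    by - (rule C_meet[of "(0,1,0)" "(a,0,1)" "(0,0,1)" "(1,b,1)"], simp_all add: C_quad False)
  then show ?thesis by (simp add: C_affine_iff)
qed (simp add: zero_in_S)

text \<open>The origin, \<open>(x, 1, 1)\<close> and \<open>(x, 1, 0)\<close> are collinear. Cutting
  their line with the line at infinity or with the horizontal line at height 1 recovers either of
  the last two points from the other.\<close>

lemma C_infinite_iff: "C (x, 1, 0) \<longleftrightarrow> x \<in> S"
proof
  assume "x \<in> S"
  then have "C (x, 1, 1)" using one_in_S by (simp add: C_affine_iff)
  then show "C (x, 1, 0)"
    by - (rule C_meet[of "(1,0,0)" "(0,1,0)" "(0,0,1)" "(x,1,1)"], simp_all add: C_quad)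
next
  assume *: "C (x, 1, 0)"
  have "C (0, 1, 1)" using one_in_S zero_in_S by (simp add: C_affine_iff)
  then have "C (x, 1, 1)"
    using * by - (rule C_meet[of "(1,0,0)" "(0,1,1)" "(0,0,1)" "(x,1,0)"], simp_all add: C_quad)
  then show "x \<in> S" by (simp add: C_affine_iff)
qed

lemma u_nz: "u \<noteq> (0, 0, 0)" and v_nz: "v \<noteq> (0, 0, 0)" and w_nz: "w \<noteq> (0, 0, 0)"
  using indep det3_nonzeroD(2) cross3_nonzeroD det3_nonzeroD(1) by blast+

text \<open>The points of \<open>B\<close> on the line joining \<open>u\<close> and \<open>w\<close>
  are \<open>pt u\<close> and one point for each element of \<open>S\<close>. That line contains two
  points of \<open>B\<close>, hence \<open>q + 1\<close> of them.\<close>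

lemma card_S: "card S = q"
proof -
  let ?l = "line_of (cross3 u w)"
  have d: "det3 u w (lc u v w x y z) = - y * det3 u v w" for x y z
    by (induct u rule: prod_induct3; induct v rule: prod_induct3; induct w rule: prod_induct3; simp add: algebra_simps)
  have cr: "cross3 u w \<noteq> (0, 0, 0)"
  proof
    assume "cross3 u w = (0, 0, 0)"
    then have "det3 u w v = 0" using dot3_cross3[of u w v] by (cases v) simp
    moreover have "det3 u w v = - det3 u v w"
      by (cases u; cases v; cases w) (simp add: algebra_simps)
    ultimately show False using indep by simp
  qed
  define f where "f x = pt (lc u v w x 0 1)" for x
  have nz: "lc u v w x 0 1 \<noteq> (0, 0, 0)" for x
    using lc_eq_zero_iff[OF indep, of x 0 1] by simp
  have "f x = f y \<Longrightarrow> x = y" for x y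
    unfolding f_def pt_eq_pt_iff[OF nz nz] smul_lc lc_eq_iff[OF indep] by auto
  then have inj: "inj_on f S" by (auto intro: inj_onI)
  have eq: "?l \<inter> B = insert (pt u) (f ` S)"
  proof (intro set_eqI iffI)
    fix X assume "X \<in> insert (pt u) (f ` S)"
    then show "X \<in> ?l \<inter> B"
      using quadrangle u_nz nz d by (auto simp: dot3_cross3 S_def C_def f_def)
  next
    fix X assume X: "X \<in> ?l \<inter> B"
    then obtain r where r: "r \<noteq> (0, 0, 0)" "X = pt r"
      using line_of_subset pg_pointsE by blast
    obtain x y z where xyz: "r = lc u v w x y z" by (rule lc_surj[OF indep])
    have y: "y = 0"
      using X r d[of x y z] indep by (simp add: dot3_cross3 xyz del: dot3_vadd)
    show "X \<in> insert (pt u) (f ` S)"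
    proof (cases "z = 0")
      case True
      then have "r = smul x u" by (cases u; cases v; cases w) (simp add: xyz y)
      moreover have "x \<noteq> 0" using r calculation by auto
      ultimately show ?thesis using r by simp
    next
      case False
      then have "r = smul z (lc u v w (x / z) 0 1)" by (simp only: smul_lc xyz y) simp
      then have "X = f (x / z)" using False r by (simp add: f_def)
      moreover have "x / z \<in> S" using X calculation by (simp add: f_def S_def C_def)
      ultimately show ?thesis by blast
    qed
  qed
  have "pt u \<noteq> pt w"
    using cross3_nonzeroD[OF cr] by simp
  then have "card (?l \<inter> B) \<ge> 2"
    by (intro card_ge_2I[of _ "pt u" "pt w"]) (use quadrangle u_nz w_nz in \<open>simp_all add: dot3_cross3\<close>)
  then have "card (?l \<inter> B) = q + 1"
    using subplane line_of_in_pg_lines[OF cr] by (auto simp: baer_subplane_def)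
  moreover have "pt u \<notin> f ` S"
  proof
    assume "pt u \<in> f ` S"
    then obtain x where "pt (lc u v w x 0 1) = pt u" by (auto simp: f_def)
    then obtain k where "u = smul k (lc u v w x 0 1)" using pt_eq_pt_iff[OF nz u_nz] by blast
    moreover have "u = lc u v w 1 0 0" by (cases u; cases v; cases w) simp
    ultimately have "lc u v w 1 0 0 = smul k (lc u v w x 0 1)" by simp
    then show False unfolding smul_lc lc_eq_iff[OF indep] by auto
  qed
  ultimately have "card (f ` S) = q" unfolding eq by simp
  then show ?thesis using card_image[OF inj] by simp
qed

lemma two_le_q: "q \<ge> 2"
proof -
  have "card {0, 1 :: 'a} \<le> card (UNIV :: 'a set)"
    by (intro card_mono) auto
  then have "q ^ 2 \<ge> 2" using card_field by simp
  then show ?thesis by (cases "q = 0"; cases "q = 1") auto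
qed

text \<open>A Fermat argument: multiplication by a nonzero \<open>x\<close> of \<open>S\<close> is
  injective on the finite set of nonzero elements of \<open>S\<close>, hence permutes it. Comparing
  the products over this set gives \<open>x ^ (q - 1) = 1\<close>.\<close>

lemma S_subset: "S \<subseteq> subq q"
proof
  fix x assume x: "x \<in> S"
  show "x \<in> subq q"
  proof (cases "x = 0")
    case True then show ?thesis using two_le_q by (simp add: subq_def)
  next
    case False
    let ?A = "S - {0}"
    have im: "(\<lambda>y. x * y) ` ?A = ?A"
      using x False S_mult by (intro endo_inj_surj) (auto simp: inj_on_def)
    have "prod (\<lambda>y. y) ?A = prod (\<lambda>y. y) ((\<lambda>y. x * y) ` ?A)"
      using im by simp
    also have "\<dots> = (\<Prod>y\<in>?A. x * y)"
      by (rule prod.reindex_cong[where l = "\<lambda>y. x * y"]) (use False in \<open>auto simp: inj_on_def\<close>)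
    also have "\<dots> = x ^ card ?A * prod (\<lambda>y. y) ?A"
      by (simp add: prod.distrib)
    finally have "x ^ card ?A = 1"
      by simp
    moreover have "card ?A = q - 1" using card_S zero_in_S by simp
    ultimately have "x ^ q = x" using two_le_q power_minus_mult[of q x] by simp
    then show ?thesis by (simp add: subq_def)
  qed
qed

lemma S_eq: "S = subq q"
proof (rule card_seteq[OF _ S_subset])
  \<comment> \<open>The polynomial \<open>x ^ q - x\<close> has at most \<open>q\<close> roots, and
    \<open>S\<close> already supplies \<open>q\<close> of them.\<close>
  let ?p = "monom 1 q - monom 1 1 :: 'a poly"
  have nz: "?p \<noteq> 0"
    using two_le_q by (auto simp: poly_eq_iff coeff_monom intro!: exI[of _ q])
  have "subq q = {x. poly ?p x = 0}"
    by (simp add: subq_def poly_monom)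
  moreover have "degree ?p \<le> q"
    using two_le_q by (intro degree_diff_le) (auto intro: order_trans[OF degree_monom_le])
  ultimately show "card (subq q :: 'a set) \<le> card S"
    using card_poly_roots_bound[OF nz] card_S by simp
qed simp

text \<open>Scaling the last nonzero coordinate to 1 leaves triples \<open>(x, y, 1)\<close>,
  \<open>(x, 1, 0)\<close> and \<open>(1, 0, 0)\<close>, for which membership is already expressed
  through \<open>S\<close>. The rescaling stays inside \<open>S\<close> because the equation
  \<open>x ^ q = x\<close> is preserved by inverses.\<close>

lemma B_eq: "B = {pt (lc u v w x y z) | x y z. x \<in> S \<and> y \<in> S \<and> z \<in> S \<and> (x, y, z) \<noteq> (0, 0, 0)}"
proof -
  have inv: "1 / x \<in> S" if "x \<in> S" for x
    using that unfolding S_eq subq_def by (simp add: power_one_over)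
  have div: "x / y \<in> S" if "x \<in> S" "y \<in> S" for x y
    using S_mult[OF that(1) inv[OF that(2)]] by simp
  have *: "pt (lc u v w x y z) \<in> B \<longleftrightarrow> C (x, y, z)" for x y z
    by (simp add: C_def)
  have red: "C (x, y, z) \<longleftrightarrow> C (x / z, y / z, 1)" if "z \<noteq> 0" for x y z
    using C_smul[of z "x / z" "y / z" 1] that by simp
  have red': "C (x, y, 0) \<longleftrightarrow> C (x / y, 1, 0)" if "y \<noteq> 0" for x y
    using C_smul[of y "x / y" 1 0] that by simp
  have red'': "C (x, 0, 0)" if "x \<noteq> 0" for x
    using C_smul[of x 1 0 0] that C_quad by simp
  have 1: "C (x, y, z)" if "x \<in> S" "y \<in> S" "z \<in> S" "(x, y, z) \<noteq> (0, 0, 0)" for x y z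
    using that red[of z x y] red'[of y x] red''[of x]
    by (cases "z = 0"; cases "y = 0") (auto simp: C_affine_iff C_infinite_iff div)
  have 2: "\<exists>a b c. a \<in> S \<and> b \<in> S \<and> c \<in> S \<and> (a, b, c) \<noteq> (0, 0, 0) \<and> pt r = pt (lc u v w a b c)"
    if "pt r \<in> B" "r \<noteq> (0, 0, 0)" for r
  proof -
    obtain x y z where xyz: "r = lc u v w x y z" by (rule lc_surj[OF indep])
    have C: "C (x, y, z)" using that * xyz by simp
    consider "z \<noteq> 0" | "z = 0" "y \<noteq> 0" | "z = 0" "y = 0" by blast
    then show ?thesis
    proof cases
      case 1
      have "r = smul z (lc u v w (x / z) (y / z) 1)"
        unfolding smul_lc xyz using 1 by simp
      then have "pt r = pt (lc u v w (x / z) (y / z) 1)" using 1 by simp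
      moreover have "x / z \<in> S" "y / z \<in> S" using C red[OF 1] by (auto simp: C_affine_iff)
      ultimately show ?thesis using one_in_S
        by (intro exI[of _ "x / z"] exI[of _ "y / z"] exI[of _ 1]) simp
    next
      case 2
      have "r = smul y (lc u v w (x / y) 1 0)"
        unfolding smul_lc xyz using 2 by simp
      then have "pt r = pt (lc u v w (x / y) 1 0)" using 2 by simp
      moreover have "x / y \<in> S" using C red'[OF 2(2)] 2 by (auto simp: C_infinite_iff)
      ultimately show ?thesis using one_in_S zero_in_S
        by (intro exI[of _ "x / y"] exI[of _ 1] exI[of _ 0]) simp
    next
      case 3
      then have "x \<noteq> 0" using that(2) xyz lc_eq_zero_iff[OF indep, of x 0 0] by simp
      moreover have "r = smul x (lc u v w 1 0 0)"
        unfolding smul_lc xyz using 3 by simp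
      ultimately have "pt r = pt (lc u v w 1 0 0)" by simp
      then show ?thesis using one_in_S zero_in_S
        by (intro exI[of _ 1] exI[of _ 0] exI[of _ 0]) simp
    qed
  qed
  have "B \<subseteq> pg_points" using subplane by (simp add: baer_subplane_def)
  show ?thesis
  proof (intro set_eqI iffI)
    fix X assume "X \<in> B"
    moreover from this obtain r where "r \<noteq> (0, 0, 0)" "X = pt r"
      using \<open>B \<subseteq> pg_points\<close> pg_pointsE by blast
    ultimately obtain a b c where "a \<in> S" "b \<in> S" "c \<in> S" "(a, b, c) \<noteq> (0, 0, 0)"
        "X = pt (lc u v w a b c)"
      using 2 by blast
    then show "X \<in> {pt (lc u v w x y z) | x y z. x \<in> S \<and> y \<in> S \<and> z \<in> S \<and> (x, y, z) \<noteq> (0, 0, 0)}"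
      by blast
  next
    fix X assume "X \<in> {pt (lc u v w x y z) | x y z. x \<in> S \<and> y \<in> S \<and> z \<in> S \<and> (x, y, z) \<noteq> (0, 0, 0)}"
    then obtain a b c where "a \<in> S" "b \<in> S" "c \<in> S" "(a, b, c) \<noteq> (0, 0, 0)"
        "X = pt (lc u v w a b c)"
      by blast
    then show "X \<in> B" using 1 * by blast
  qed
qed

end

lemma det3_smul: "det3 (smul a u) (smul b v) (smul c w) = a * b * c * det3 u v w"
  by (cases u; cases v; cases w) (simp add: algebra_simps)

lemma det3_quadrangle:
  fixes a b c :: "('a::{field,finite}) vec3"
  assumes Q: "\<forall>l\<in>pg_lines. card (l \<inter> Q) \<le> 2" "pt a \<in> Q" "pt b \<in> Q" "pt c \<in> Q"
    and nz: "a \<noteq> (0, 0, 0)" "b \<noteq> (0, 0, 0)" "c \<noteq> (0, 0, 0)"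
    and ne: "pt a \<noteq> pt b" "pt a \<noteq> pt c" "pt b \<noteq> pt c"
  shows "det3 a b c \<noteq> 0"
proof
  assume "det3 a b c = 0"
  have "cross3 a b \<noteq> (0, 0, 0)" using cross3_eq_zero_iff nz ne by blast
  then have "line_of (cross3 a b) \<in> pg_lines" by (rule line_of_in_pg_lines)
  then have "card (line_of (cross3 a b) \<inter> Q) \<le> 2" using Q by blast
  moreover have "{pt a, pt b, pt c} \<subseteq> line_of (cross3 a b) \<inter> Q"
    using Q nz \<open>det3 a b c = 0\<close> by (simp add: dot3_cross3)
  then have "card {pt a, pt b, pt c} \<le> card (line_of (cross3 a b) \<inter> Q)"
    by (rule card_mono[OF finite])
  ultimately show False using ne by simp
qed

lemma baer_subplane_coordinates:
  fixes B :: "('a::{field,finite}) vec3 set set"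
  assumes card: "card (UNIV :: 'a set) = q ^ 2" and B: "baer_subplane q B"
  obtains u v w where "coord_subplane q B u v w"
proof -
  obtain Q where Q: "Q \<subseteq> B" "card Q = 4" "\<forall>l\<in>pg_lines. card (l \<inter> Q) \<le> 2"
    using B unfolding baer_subplane_def by blast
  obtain A1 A2 A3 A4 where A: "Q = {A1, A2, A3, A4}"
    "A1 \<noteq> A2" "A1 \<noteq> A3" "A1 \<noteq> A4" "A2 \<noteq> A3" "A2 \<noteq> A4" "A3 \<noteq> A4"
    using Q(2) by (auto simp: numeral_eq_Suc card_Suc_eq)
  have "Q \<subseteq> pg_points" using Q B by (auto simp: baer_subplane_def)
  then have pg: "A1 \<in> pg_points" "A2 \<in> pg_points" "A3 \<in> pg_points" "A4 \<in> pg_points"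
    using A(1) by auto
  obtain a where a: "a \<noteq> (0, 0, 0)" "A1 = pt a" using pg(1) by (rule pg_pointsE)
  obtain b where b: "b \<noteq> (0, 0, 0)" "A2 = pt b" using pg(2) by (rule pg_pointsE)
  obtain c where c: "c \<noteq> (0, 0, 0)" "A3 = pt c" using pg(3) by (rule pg_pointsE)
  obtain d where d: "d \<noteq> (0, 0, 0)" "A4 = pt d" using pg(4) by (rule pg_pointsE)
  note v = a(1) b(1) c(1) d(1) and eq = a(2) b(2) c(2) d(2)
  note d3 = det3_quadrangle[OF Q(3)]
  have det: "det3 a b c \<noteq> 0" "det3 a b d \<noteq> 0" "det3 b c d \<noteq> 0" "det3 a c d \<noteq> 0"
    by (rule d3; use A v eq in simp)+
  obtain x y z where xyz: "d = lc a b c x y z" by (rule lc_surj[OF det(1)])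
  have "det3 a b (lc a b c x y z) = z * det3 a b c" "det3 b c (lc a b c x y z) = x * det3 a b c"
    "det3 a c (lc a b c x y z) = - y * det3 a b c"
    by (induct a rule: prod_induct3; induct b rule: prod_induct3; induct c rule: prod_induct3;
        simp add: algebra_simps)+
  then have nz: "x \<noteq> 0" "y \<noteq> 0" "z \<noteq> 0" using det xyz by auto
  \<comment> \<open>Rescaling three points of the quadrangle by the coordinates of the fourth turns
    the fourth into the unit point. These coordinates are nonzero because no three of the four
    points are collinear.\<close>
  have "coord_subplane q B (smul x a) (smul y b) (smul z c)"
  proof
    show "det3 (smul x a) (smul y b) (smul z c) \<noteq> 0" using nz det by (simp add: det3_smul)
    show "pt (lc (smul x a) (smul y b) (smul z c) 1 1 1) \<in> B"
      using Q A eq xyz by simp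
  qed (use nz Q A eq B card in auto)
  then show ?thesis by (rule that)
qed

section \<open>The field as a plane over its subfield, and frames adapted to the tangent point and
  the vertex\<close>

locale quadratic_extension =
  fixes q :: nat and K :: "('a::{field,finite}) set" and \<theta> :: 'a
  assumes K_def: "K = subq q" and card_K: "card K = q" and two_le_q: "q \<ge> 2"
    and card_field: "card (UNIV :: 'a set) = q ^ 2"
    and K_add: "a \<in> K \<Longrightarrow> b \<in> K \<Longrightarrow> a + b \<in> K"
    and \<theta>: "\<theta> \<notin> K"
begin

lemma K_zero [simp]: "0 \<in> K" and K_one [simp]: "1 \<in> K"
  using two_le_q by (auto simp: K_def subq_def)

lemma K_mult: "a \<in> K \<Longrightarrow> b \<in> K \<Longrightarrow> a * b \<in> K"
  by (simp add: K_def subq_def power_mult_distrib)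

lemma K_divide: "a \<in> K \<Longrightarrow> b \<in> K \<Longrightarrow> a / b \<in> K"
  by (simp add: K_def subq_def power_divide)

lemma K_uminus: assumes "a \<in> K" shows "- a \<in> K"
proof -
  \<comment> \<open>Translation by \<open>a\<close> maps the finite set \<open>K\<close> injectively
    into itself, hence onto itself, and so reaches 0.\<close>
  have "(+) a ` K = K"
    using K_add assms by (intro endo_inj_surj) auto
  then obtain b where "b \<in> K" "0 = a + b" using K_zero by (metis imageE)
  then show ?thesis by (metis add_eq_0_iff)
qed

lemma K_diff: "a \<in> K \<Longrightarrow> b \<in> K \<Longrightarrow> a - b \<in> K"
  using K_add[OF _ K_uminus] by fastforce

lemmas K_closed = K_add K_mult K_divide K_uminus K_diff K_zero K_one

text \<open>If the coefficients of \<open>\<theta>\<close> differed, \<open>\<theta>\<close> would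
  be a quotient of elements of \<open>K\<close>.\<close>

lemma repr_unique:
  assumes "m \<in> K" "n \<in> K" "m' \<in> K" "n' \<in> K" "m + n * \<theta> = m' + n' * \<theta>"
  shows "m = m' \<and> n = n'"
proof (cases "n = n'")
  case False
  then have "\<theta> = (m - m') / (n' - n)" using assms(5) by (simp add: field_simps)
  then show ?thesis using \<theta> assms K_closed by metis
qed (use assms in simp)

lemma repr_zero_iff: "m \<in> K \<Longrightarrow> n \<in> K \<Longrightarrow> m + n * \<theta> = 0 \<longleftrightarrow> m = 0 \<and> n = 0"
  using repr_unique[of m n 0 0] by auto

text \<open>By counting: uniqueness gives \<open>q ^ 2\<close> distinct combinations in a field of
  \<open>q ^ 2\<close> elements.\<close>

lemma repr_exists: obtains m n where "m \<in> K" "n \<in> K" "x = m + n * \<theta>"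
proof -
  let ?f = "\<lambda>(m, n). m + n * \<theta>"
  have "inj_on ?f (K \<times> K)" using repr_unique by (auto intro!: inj_onI)
  then have "card (?f ` (K \<times> K)) = card (UNIV :: 'a set)"
    by (simp add: card_image card_cartesian_product card_K card_field power2_eq_square)
  then have "?f ` (K \<times> K) = UNIV"
    by (intro card_subset_eq) auto
  then have "x \<in> ?f ` (K \<times> K)" by simp
  then show ?thesis using that by auto
qed

end

text \<open>On the \<open>K\<close>-span of the frame, \<open>E\<close> sends the combination with
  coefficients \<open>x\<close>, \<open>y\<close>, \<open>z\<close> to
  \<open>y + z * \<theta>\<close>. It vanishes there only on multiples of \<open>u\<close>, which
  expresses tangency at \<open>pt u\<close>.\<close>

locale baer_frame = quadratic_extension q K \<theta>
  for q :: nat and K :: "('a::{field,finite}) set" and \<theta> :: 'a +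
  fixes B linf :: "'a vec3 set set" and u v w E :: "'a vec3"
  assumes subplane: "baer_subplane q B"
    and indep: "det3 u v w \<noteq> 0"
    and B_eq: "B = {pt (lc u v w x y z) | x y z. x \<in> K \<and> y \<in> K \<and> z \<in> K \<and> (x, y, z) \<noteq> (0, 0, 0)}"
    and linf_eq: "linf = line_of E"
    and E [simp]: "dot3 E u = 0" "dot3 E v = 1" "dot3 E w = \<theta>"

text \<open>Excluding the zero triple is the same as excluding the zero vector. Thus
  \<open>B\<close> is determined by the \<open>S\<close>-span as a set of vectors, and changing the
  frame only requires checking that this span stays the same.\<close>

lemma lc_span_points:
  assumes "det3 u v w \<noteq> 0"
  shows "{pt (lc u v w x y z) | x y z. x \<in> S \<and> y \<in> S \<and> z \<in> S \<and> (x, y, z) \<noteq> (0, 0, 0)}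
    = {pt r | r. r \<in> {lc u v w x y z | x y z. x \<in> S \<and> y \<in> S \<and> z \<in> S} \<and> r \<noteq> (0, 0, 0)}"
    (is "?L = ?R")
proof (intro set_eqI iffI)
  have z: "lc u v w x y z = (0, 0, 0) \<longleftrightarrow> (x, y, z) = (0, 0, 0)" for x y z
    using lc_eq_zero_iff[OF assms, of x y z] by simp
  fix X
  {
    assume "X \<in> ?L"
    then obtain x y z where "x \<in> S" "y \<in> S" "z \<in> S" "(x, y, z) \<noteq> (0, 0, 0)" "X = pt (lc u v w x y z)"
      by blast
    then show "X \<in> ?R" using z[of x y z] by blast
  next
    assume "X \<in> ?R"
    then obtain x y z where "x \<in> S" "y \<in> S" "z \<in> S" "lc u v w x y z \<noteq> (0, 0, 0)"
      "X = pt (lc u v w x y z)"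
      by blast
    then show "X \<in> ?L" using z[of x y z] by blast
  }
qed

text \<open>The covector of the line at infinity, restricted to the span \<open>V\<close> of
  \<open>B\<close>, is linear over the subfield with values in a plane over it. Tangency makes its
  kernel a line spanned by \<open>t\<close>. Lifting 1 and a second independent value completes
  \<open>t\<close> to a basis, and adding multiples of \<open>t\<close> then moves the vertex into
  the required position.\<close>

lemma baer_frame_exists:
  fixes B linf :: "('a::{field,finite}) vec3 set set"
  assumes card: "card (UNIV :: 'a set) = q ^ 2"
    and linf: "linf \<in> pg_lines" and B: "baer_subplane q B"
    and T: "linf \<inter> B = {T}" and P: "P \<in> linf" "P \<noteq> T"
  obtains \<theta> u v w E where "baer_frame q (subq q) \<theta> B linf u v w E" "T = pt u"
    "P = pt (vadd w (smul (- \<theta>) v))"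
proof -
  obtain a b c where "coord_subplane q B a b c"
    by (rule baer_subplane_coordinates[OF card B])
  then interpret coord_subplane q B a b c .
  define V where "V = {lc a b c x y z | x y z. x \<in> S \<and> y \<in> S \<and> z \<in> S}"
  note ind = lc_eq_zero_iff[OF indep]
  have B_V: "B = {pt r | r. r \<in> V \<and> r \<noteq> (0, 0, 0)}"
    unfolding V_def by (rule trans[OF B_eq lc_span_points[OF indep]])
  have qext: "quadratic_extension q (subq q) \<theta>" if "\<theta> \<notin> S" for \<theta> :: 'a
    by unfold_locales (use that S_eq card_S two_le_q card_field S_add in auto)
  \<comment> \<open>An arbitrary element outside \<open>S\<close> gives early access to the closure
    properties of a subfield. The final \<open>\<theta>\<close> is a value of \<open>E\<close> at a
    vector that is chosen later.\<close>
  obtain \<theta>0 :: 'a where "\<theta>0 \<notin> S"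
  proof -
    have "q ^ 2 \<noteq> q" using two_le_q by (simp add: power2_eq_square)
    then have "S \<noteq> UNIV" using card_S card by metis
    then show ?thesis using that by blast
  qed
  interpret Q0: quadratic_extension q "S" \<theta>0
    using qext[OF \<open>\<theta>0 \<notin> S\<close>] S_eq by simp
  have V_add: "vadd r s \<in> V" if "r \<in> V" "s \<in> V" for r s
  proof -
    obtain x y z x' y' z' where e: "r = lc a b c x y z" "s = lc a b c x' y' z'"
      and m: "x \<in> S" "y \<in> S" "z \<in> S" "x' \<in> S" "y' \<in> S" "z' \<in> S"
      using \<open>r \<in> V\<close> \<open>s \<in> V\<close> unfolding V_def by blast
    have "vadd r s = lc a b c (x + x') (y + y') (z + z')"
      unfolding e by (cases a; cases b; cases c) (simp add: algebra_simps)
    then show ?thesis unfolding V_def using S_add m by blast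
  qed
  have V_smul: "smul k r \<in> V" if "r \<in> V" "k \<in> S" for r k
    using that S_mult unfolding V_def by (auto simp: smul_lc simp del: smul_smul; blast)
  have V_covector: "n = (0, 0, 0)" if "\<forall>r\<in>V. dot3 n r = 0" for n
  proof (rule covector_eq_zero[OF indep])
    have "a = lc a b c 1 0 0" "b = lc a b c 0 1 0" "c = lc a b c 0 0 1"
      by (cases a; cases b; cases c; simp)+
    then have "a \<in> V" "b \<in> V" "c \<in> V" unfolding V_def using zero_in_S one_in_S by blast+
    then show "dot3 n a = 0" "dot3 n b = 0" "dot3 n c = 0" using that by blast+
  qed
  obtain e where e: "e \<noteq> (0, 0, 0)" "linf = line_of e" using linf by (rule pg_linesE)
  obtain t where t: "t \<in> V" "t \<noteq> (0, 0, 0)" "T = pt t" using T B_V by blast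
  have "pt t \<in> line_of e" using T t e by blast
  then have et: "dot3 e t = 0" using t by simp
  \<comment> \<open>Tangency: a nonzero vector of \<open>V\<close> in the kernel represents
    \<open>T\<close>, so it is a multiple of \<open>t\<close>. The factor is a quotient of
    coordinates in \<open>S\<close>, hence itself in \<open>S\<close>.\<close>
  have ker: "\<exists>k\<in>S. r = smul k t" if "r \<in> V" "dot3 e r = 0" for r
  proof (cases "r = (0, 0, 0)")
    case True
    then show ?thesis using zero_in_S by (intro bexI[of _ 0]) simp_all
  next
    case False
    then have "pt r \<in> line_of e" using that by simp
    moreover have "pt r \<in> B" unfolding B_V using that False by blast
    ultimately have "pt r \<in> linf \<inter> B" using e by simp
    then have "pt t = pt r" using T t by auto
    then obtain k where k: "r = smul k t" using pt_eq_pt_iff t False by blast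
    obtain x y z where xyz: "t = lc a b c x y z" "x \<in> S" "y \<in> S" "z \<in> S"
      using t unfolding V_def by blast
    obtain x' y' z' where xyz': "r = lc a b c x' y' z'" "x' \<in> S" "y' \<in> S" "z' \<in> S"
      using \<open>r \<in> V\<close> unfolding V_def by blast
    have eqs: "x' = k * x" "y' = k * y" "z' = k * z"
      using k unfolding xyz xyz' smul_lc lc_eq_iff[OF indep] by auto
    have "x \<noteq> 0 \<or> y \<noteq> 0 \<or> z \<noteq> 0" using t xyz ind by auto
    then have "k = x' / x \<or> k = y' / y \<or> k = z' / z" using eqs by auto
    then have "k \<in> S" using xyz xyz' Q0.K_divide by metis
    then show ?thesis using k by blast
  qed
  obtain v1 where v1: "v1 \<in> V" "dot3 e v1 \<noteq> 0" using V_covector[of e] e by blast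
  define E where "E = smul (1 / dot3 e v1) e"
  have E: "dot3 E v1 = 1" "dot3 E t = 0" "linf = line_of E"
    using v1 et e by (simp_all add: E_def)
  have Eker: "\<exists>k\<in>S. r = smul k t" if "r \<in> V" "dot3 E r = 0" for r
    using that ker v1 by (simp add: E_def)
  have cross: "cross3 t v1 \<noteq> (0, 0, 0)"
  proof
    assume "cross3 t v1 = (0, 0, 0)"
    moreover have v1_nz: "v1 \<noteq> (0, 0, 0)" using v1 by auto
    ultimately have "pt t = pt v1" using cross3_eq_zero_iff[OF t(2) v1_nz] by simp
    then obtain k where "v1 = smul k t" using pt_eq_pt_iff[OF t(2) v1_nz] by blast
    then show False using E by simp
  qed
  obtain v2 where v2: "v2 \<in> V" "dot3 E v2 \<notin> S"
  proof -
    \<comment> \<open>A vector \<open>r\<close> of \<open>V\<close> off the line through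
      \<open>t\<close> and \<open>v1\<close> works. If its value under \<open>E\<close> were in
      \<open>S\<close>, subtracting that multiple of \<open>v1\<close> would leave a multiple of
      \<open>t\<close>, and \<open>r\<close> would lie on the line after all.\<close>
    have "\<exists>r\<in>V. dot3 (cross3 t v1) r \<noteq> 0" using V_covector[of "cross3 t v1"] cross by blast
    then obtain r where r: "r \<in> V" "dot3 (cross3 t v1) r \<noteq> 0" by blast
    have "dot3 E r \<notin> S"
    proof
      assume *: "dot3 E r \<in> S"
      let ?s = "vadd r (smul (- dot3 E r) v1)"
      have "?s \<in> V" by (intro V_add V_smul Q0.K_uminus r v1 *)
      moreover have "dot3 E ?s = 0" using E by simp
      ultimately obtain k where "?s = smul k t" using Eker by blast
      then have "dot3 (cross3 t v1) ?s = 0" by (simp add: dot3_cross3)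
      then show False using r by (simp add: dot3_cross3)
    qed
    then show ?thesis using r that by blast
  qed
  define \<theta> where "\<theta> = dot3 E v2"
  interpret Q: quadratic_extension q "S" \<theta>
    using qext[of \<theta>] v2 S_eq by (simp add: \<theta>_def)
  \<comment> \<open>The value of \<open>E\<close> at \<open>r\<close> determines the coefficients of
    \<open>v1\<close> and \<open>v2\<close>; what remains is in the kernel of \<open>E\<close> and
    gives the coefficient of \<open>t\<close>.\<close>
  have V_lc: "\<exists>x y z. x \<in> S \<and> y \<in> S \<and> z \<in> S \<and> r = lc t v1 v2 x y z" if "r \<in> V" for r
  proof -
    obtain m n where mn: "m \<in> S" "n \<in> S" "dot3 E r = m + n * \<theta>" by (rule Q.repr_exists)
    let ?s = "vadd r (vadd (smul (- m) v1) (smul (- n) v2))"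
    have "?s \<in> V" by (intro V_add V_smul Q.K_uminus that v1 v2 mn)
    moreover have "dot3 E ?s = 0" using E mn by (simp add: \<theta>_def)
    ultimately obtain k where k: "k \<in> S" "?s = smul k t" using Eker by blast
    have "r = vadd ?s (vadd (smul m v1) (smul n v2))"
      by (cases r; cases v1; cases v2) (simp add: algebra_simps)
    then have "r = lc t v1 v2 k m n" using k by simp
    then show ?thesis using k mn by blast
  qed
  have det: "det3 t v1 v2 \<noteq> 0"
  proof
    assume 0: "det3 t v1 v2 = 0"
    have "dot3 (cross3 t v1) r = 0" if "r \<in> V" for r
    proof -
      obtain x y z where "r = lc t v1 v2 x y z" using V_lc \<open>r \<in> V\<close> by blast
      then show ?thesis
        by (simp only: dot3_vadd dot3_smul) (simp add: dot3_cross3 0)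
    qed
    then show False using V_covector[of "cross3 t v1"] cross by blast
  qed
  obtain p where p: "p \<noteq> (0, 0, 0)" "P = pt p" using P e line_of_subset pg_pointsE by blast
  obtain x m n where xmn: "p = lc t v1 v2 x m n" by (rule lc_surj[OF det])
  have "dot3 E p = 0" using P E p by simp
  then have m: "m = - n * \<theta>" using E by (simp add: xmn \<theta>_def add_eq_0_iff2)
  have "n \<noteq> 0"
  proof
    assume "n = 0"
    then have "p = smul x t" using m by (cases t; cases v1; cases v2) (simp add: xmn)
    then show False using p P t by auto
  qed
  \<comment> \<open>After division by \<open>n\<close>, the vector \<open>p\<close> is
    \<open>v2 - \<theta> v1 + (k1 + k2 \<theta>) t\<close>. The \<open>t\<close>-part is absorbed by
    adding \<open>k1 t\<close> to \<open>v2\<close> and subtracting \<open>k2 t\<close> from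
    \<open>v1\<close>, which keeps both vectors in \<open>V\<close>.\<close>
  obtain k1 k2 where k: "k1 \<in> S" "k2 \<in> S" "x / n = k1 + k2 * \<theta>" by (rule Q.repr_exists)
  have x: "x = n * (k1 + k2 * \<theta>)" using k(3) \<open>n \<noteq> 0\<close> by (simp add: field_simps)
  define v where "v = vadd v1 (smul (- k2) t)"
  define w where "w = vadd v2 (smul k1 t)"
  have "p = smul n (vadd w (smul (- \<theta>) v))"
    unfolding v_def w_def xmn x m by (cases t; cases v1; cases v2) (simp add: algebra_simps)
  then have P': "P = pt (vadd w (smul (- \<theta>) v))" using p \<open>n \<noteq> 0\<close> by simp
  have lc': "lc t v w x y z = lc t v1 v2 (x - y * k2 + z * k1) y z" for x y z
    unfolding v_def w_def by (cases t; cases v1; cases v2) (simp add: algebra_simps)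
  have det': "det3 t v w = det3 t v1 v2"
    unfolding v_def w_def
    by (induct t rule: prod_induct3; induct v1 rule: prod_induct3; induct v2 rule: prod_induct3)
      (simp add: algebra_simps)
  have V_eq: "V = {lc t v w x y z | x y z. x \<in> S \<and> y \<in> S \<and> z \<in> S}"
  proof (intro set_eqI iffI)
    fix r assume "r \<in> V"
    then obtain x y z where xyz: "x \<in> S" "y \<in> S" "z \<in> S" "r = lc t v1 v2 x y z" using V_lc by blast
    have "r = lc t v w (x + y * k2 - z * k1) y z" unfolding lc' xyz(4) by simp
    moreover have "x + y * k2 - z * k1 \<in> S" using xyz k by (simp add: Q.K_closed)
    ultimately show "r \<in> {lc t v w x y z | x y z. x \<in> S \<and> y \<in> S \<and> z \<in> S}" using xyz by blast
  next
    fix r assume "r \<in> {lc t v w x y z | x y z. x \<in> S \<and> y \<in> S \<and> z \<in> S}"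
    moreover have "v \<in> V" "w \<in> V"
      unfolding v_def w_def by (intro V_add V_smul Q.K_uminus v1 v2 t k)+
    ultimately show "r \<in> V" by (auto intro!: V_add V_smul t)
  qed
  have "baer_frame q (subq q) \<theta> B linf t v w E"
  proof (intro baer_frame.intro baer_frame_axioms.intro)
    show "quadratic_extension q (subq q) \<theta>" using Q.quadratic_extension_axioms S_eq by simp
    show "det3 t v w \<noteq> 0" using det det' by simp
    show "dot3 E t = 0" "dot3 E v = 1" "dot3 E w = \<theta>" using E by (simp_all add: v_def w_def \<theta>_def)
    show "B = {pt (lc t v w x y z) |x y z. x \<in> subq q \<and> y \<in> subq q \<and> z \<in> subq q \<and> (x, y, z) \<noteq> (0, 0, 0)}"
      unfolding S_eq[symmetric] lc_span_points[OF \<open>det3 t v w \<noteq> 0\<close>] V_eq[symmetric] by (rule B_V)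
  qed (use B E in auto)
  then show ?thesis using that t P' by blast
qed

section \<open>Pencils as affine lines over the subfield\<close>

context quadratic_extension
begin

text \<open>For \<open>c \<noteq> 0\<close> these are the affine lines of the field regarded as an
  affine plane over \<open>K\<close>.\<close>

definition aff :: "'a \<Rightarrow> 'a \<Rightarrow> 'a set" where
  "aff c d = (\<lambda>k. c * k + d) ` K"

text \<open>Write \<open>d / c = a + b * \<theta>\<close>. The summand \<open>a\<close> is absorbed
  by translating the parameter; a nonzero \<open>b\<close> is absorbed by rescaling it, with
  \<open>g = c * b\<close>.\<close>

lemma aff_cases:
  assumes "c \<noteq> 0"
  obtains g where "g \<noteq> 0" "aff c d = aff g 0 \<or> aff c d = aff g (g * \<theta>)"
proof -
  obtain a b where ab: "a \<in> K" "b \<in> K" "d / c = a + b * \<theta>" by (rule repr_exists)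
  have d: "d = c * a + c * b * \<theta>" using ab(3) assms by (simp add: field_simps)
  have shift: "(\<lambda>k. (k + a) / e) ` K = K" if "e \<in> K" "e \<noteq> 0" for e
  proof (intro endo_inj_surj)
    show "(\<lambda>k. (k + a) / e) ` K \<subseteq> K" by (auto intro!: K_divide K_add ab that)
    show "inj_on (\<lambda>k. (k + a) / e) K" using that by (auto simp: inj_on_def)
  qed simp
  show ?thesis
  proof (cases "b = 0")
    case True
    have "aff c d = (\<lambda>k. c * k + 0) ` (\<lambda>k. (k + a) / 1) ` K"
      unfolding aff_def image_image by (simp add: d True algebra_simps)
    then have "aff c d = aff c 0" using shift[of 1] unfolding aff_def by simp
    then show ?thesis using that assms by blast
  next
    case False
    have "aff c d = (\<lambda>k. c * b * k + c * b * \<theta>) ` (\<lambda>k. (k + a) / b) ` K"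
      unfolding aff_def image_image d using False by (intro image_cong) (simp_all add: field_simps)
    then have "aff c d = aff (c * b) (c * b * \<theta>)"
      unfolding shift[OF ab(2) False] aff_def .
    then show ?thesis using that[of "c * b"] assms False by simp
  qed
qed

text \<open>The points of the first line with parameters 0 and 1 have parameters \<open>k\<close>
  and \<open>l\<close> on the second. Their difference gives \<open>g = h * (l - k)\<close>, and
  comparing coefficients of \<open>\<theta>\<close> gives \<open>l - k = 1\<close>.\<close>

lemma aff_theta_inj:
  assumes "g \<noteq> 0" "h \<noteq> 0" "aff g (g * \<theta>) = aff h (h * \<theta>)"
  shows "g = h"
proof -
  have "g * 0 + g * \<theta> \<in> aff g (g * \<theta>)" "g * 1 + g * \<theta> \<in> aff g (g * \<theta>)"
    unfolding aff_def by (rule imageI; simp)+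
  then obtain k l where kl: "k \<in> K" "l \<in> K" "g * \<theta> = h * k + h * \<theta>" "g + g * \<theta> = h * l + h * \<theta>"
    unfolding assms(3) by (auto simp: aff_def)
  have g: "g = h * (l - k)" using kl(3,4) by (simp add: algebra_simps)
  have "h * (0 + (l - k) * \<theta>) = h * (k + 1 * \<theta>)" using kl(3) by (simp add: g algebra_simps)
  then have "0 + (l - k) * \<theta> = k + 1 * \<theta>" using assms(2) mult_left_cancel by blast
  then have "0 = k \<and> l - k = 1" by (intro repr_unique K_closed kl(1,2))
  then show ?thesis unfolding g by auto
qed

lemma zero_notin_aff_theta: "g \<noteq> 0 \<Longrightarrow> 0 \<notin> aff g (g * \<theta>)"
proof
  assume "g \<noteq> 0" "0 \<in> aff g (g * \<theta>)"
  then obtain k where k: "k \<in> K" "g * (k + \<theta>) = 0" by (auto simp: aff_def algebra_simps)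
  then have "\<theta> = - k" using \<open>g \<noteq> 0\<close> by (simp add: add_eq_0_iff)
  then show False using k K_uminus \<theta> by simp
qed

lemma zero_in_aff: "0 \<in> aff g 0"
  unfolding aff_def by (rule image_eqI[of _ _ 0]) simp_all

lemma aff_scale:
  assumes "k \<in> K" "k \<noteq> 0"
  shows "aff (g * k) 0 = aff g 0"
proof -
  have "(*) k ` K = K"
    using assms K_mult by (intro endo_inj_surj) (auto simp: inj_on_def)
  then have "aff g 0 = (\<lambda>l. g * l + 0) ` ((*) k ` K)" by (simp add: aff_def)
  then show ?thesis unfolding aff_def image_image by (simp add: algebra_simps)
qed

text \<open>The lines through 0 form a projective line over \<open>K\<close>. By
  \<open>aff_scale\<close> each has a direction 1 or \<open>a + \<theta>\<close> with
  \<open>a\<close> in \<open>K\<close>, and these directions are pairwise non-proportional over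
  \<open>K\<close>.\<close>

lemma card_aff_zero: "card {aff g 0 | g. g \<noteq> 0} = q + 1"
proof -
  have "{aff g 0 | g. g \<noteq> 0} = insert (aff 1 0) ((\<lambda>a. aff (a + \<theta>) 0) ` K)"
  proof (intro set_eqI iffI)
    fix l assume "l \<in> {aff g 0 | g. g \<noteq> 0}"
    then obtain g where g: "g \<noteq> 0" "l = aff g 0" by blast
    obtain m n where mn: "m \<in> K" "n \<in> K" "g = m + n * \<theta>" by (rule repr_exists)
    show "l \<in> insert (aff 1 0) ((\<lambda>a. aff (a + \<theta>) 0) ` K)"
    proof (cases "n = 0")
      case True
      then have "aff (1 * m) 0 = aff 1 0" using mn g by (intro aff_scale) auto
      then show ?thesis using g mn True by simp
    next
      case False
      have "g = (m / n + \<theta>) * n" using mn False by (simp add: field_simps)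
      then have "l = aff (m / n + \<theta>) 0" using g aff_scale[OF mn(2) False] by simp
      moreover have "m / n \<in> K" using mn K_divide by simp
      ultimately show ?thesis by blast
    qed
  next
    fix l assume "l \<in> insert (aff 1 0) ((\<lambda>a. aff (a + \<theta>) 0) ` K)"
    moreover have "a + \<theta> \<noteq> 0" if "a \<in> K" for a
      using repr_zero_iff[of a 1] that by simp
    ultimately show "l \<in> {aff g 0 | g. g \<noteq> 0}" using one_neq_zero by blast
  qed
  moreover have "inj_on (\<lambda>a. aff (a + \<theta>) 0) K"
  proof (rule inj_onI)
    fix a b assume ab: "a \<in> K" "b \<in> K" "aff (a + \<theta>) 0 = aff (b + \<theta>) 0"
    have "(a + \<theta>) * 1 + 0 \<in> aff (a + \<theta>) 0" unfolding aff_def by (rule imageI) simp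
    then obtain k where k: "k \<in> K" "a + \<theta> = (b + \<theta>) * k" unfolding ab(3) by (auto simp: aff_def)
    then have "a + 1 * \<theta> = b * k + k * \<theta>" by (simp add: algebra_simps)
    then have "a = b * k \<and> 1 = k" using ab k by (intro repr_unique K_closed)
    then show "a = b" by auto
  qed
  moreover have "aff 1 0 \<notin> (\<lambda>a. aff (a + \<theta>) 0) ` K"
  proof
    assume "aff 1 0 \<in> (\<lambda>a. aff (a + \<theta>) 0) ` K"
    then obtain a where a: "a \<in> K" "aff 1 0 = aff (a + \<theta>) 0" by blast
    have "1 * 1 + 0 \<in> aff 1 0" unfolding aff_def by (rule imageI) simp
    then obtain k where k: "k \<in> K" "1 = (a + \<theta>) * k" unfolding a(2) by (auto simp: aff_def)
    then have "1 + 0 * \<theta> = a * k + k * \<theta>" by (simp add: algebra_simps)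
    then have "1 = a * k \<and> 0 = k" using a k by (intro repr_unique K_closed)
    then show False by auto
  qed
  ultimately show ?thesis by (simp add: card_image card_K)
qed

text \<open>The only point with \<open>r = 0\<close> is \<open>pt a\<close>; scaling
  \<open>r\<close> to 1 brings the others to the form \<open>(t ^ 2, t, 1)\<close>.\<close>

lemma card_nondeg_conic:
  fixes B C :: "'a vec3 set set"
  assumes "nondeg_conic_of q B C"
  shows "card C \<le> q + 1"
proof -
  obtain a b c where C: "C = {pt (lc a b c s t r) | s t r.
      s \<in> K \<and> t \<in> K \<and> r \<in> K \<and> (s, t, r) \<noteq> (0, 0, 0) \<and> s * r = t ^ 2}"
    using assms unfolding nondeg_conic_of_def K_def by blast
  have "C \<subseteq> insert (pt a) ((\<lambda>t. pt (lc a b c (t ^ 2) t 1)) ` K)"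
  proof
    fix R assume "R \<in> C"
    then obtain s t r where str: "R = pt (lc a b c s t r)" "s \<in> K" "t \<in> K" "r \<in> K"
      "(s, t, r) \<noteq> (0, 0, 0)" "s * r = t ^ 2"
      unfolding C by blast
    show "R \<in> insert (pt a) ((\<lambda>t. pt (lc a b c (t ^ 2) t 1)) ` K)"
    proof (cases "r = 0")
      case True
      then have "t = 0" "s \<noteq> 0" using str by auto
      moreover have "lc a b c s 0 0 = smul s a" by (cases a; cases b; cases c) simp
      ultimately show ?thesis using True str by simp
    next
      case False
      have "s = r * (t / r) ^ 2" using str(6) False by (simp add: field_simps power2_eq_square)
      then have "lc a b c s t r = smul r (lc a b c ((t / r) ^ 2) (t / r) 1)"
        unfolding smul_lc using False by simp
      then have "R = pt (lc a b c ((t / r) ^ 2) (t / r) 1)" using str False by simp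
      then show ?thesis using str K_divide by blast
    qed
  qed
  then have "card C \<le> card (insert (pt a) ((\<lambda>t. pt (lc a b c (t ^ 2) t 1)) ` K))"
    by (rule card_mono[OF finite])
  also have "\<dots> \<le> Suc (card K)"
    by (simp add: card_insert_if card_image_le le_SucI)
  finally show ?thesis by (simp add: card_K)
qed

end

section \<open>The lines through the vertex and their affine coordinate\<close>

context baer_frame
begin

text \<open>The covector dual to \<open>u\<close> in the basis \<open>u\<close>, \<open>v\<close>,
  \<open>w\<close>.\<close>

definition X :: "'a vec3" where "X = smul (1 / det3 u v w) (cross3 v w)"

definition p0 :: "'a vec3" where "p0 = vadd w (smul (- \<theta>) v)"

abbreviation P :: "'a vec3 set" where "P \<equiv> pt p0"

lemma X [simp]: "dot3 X u = 1" "dot3 X v = 0" "dot3 X w = 0"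
proof -
  have "det3 v w u = det3 u v w" by (cases u; cases v; cases w) (simp add: algebra_simps)
  then show "dot3 X u = 1" "dot3 X v = 0" "dot3 X w = 0"
    using indep by (simp_all add: X_def dot3_cross3)
qed

lemma XE_p0 [simp]: "dot3 X p0 = 0" "dot3 E p0 = 0"
  by (simp_all add: p0_def)

lemma p0_nz [simp]: "p0 \<noteq> (0, 0, 0)"
proof -
  have "p0 = lc u v w 0 (- \<theta>) 1" unfolding p0_def by (cases u; cases v; cases w) simp
  then show ?thesis using lc_eq_zero_iff[OF indep, of 0 "- \<theta>" 1] by simp
qed

lemma u_nz [simp]: "u \<noteq> (0, 0, 0)" by (metis X(1) dot3_zero zero_neq_one)

lemma E_nz [simp]: "E \<noteq> (0, 0, 0)" by (metis E(2) dot3_zero_left zero_neq_one)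

lemma X_nz [simp]: "X \<noteq> (0, 0, 0)" by (metis X(1) dot3_zero_left zero_neq_one)

text \<open>The common zeros of \<open>X\<close> and \<open>E\<close> form the vertex, so the ratio
  of \<open>X\<close> to \<open>E\<close> is a coordinate on the lines through it.\<close>

lemma XE_zeroE:
  assumes "dot3 X r = 0" "dot3 E r = 0"
  obtains c where "r = smul c p0"
proof -
  obtain x y z where r: "r = lc u v w x y z" by (rule lc_surj[OF indep])
  have "x = 0" "y = - z * \<theta>" using assms by (simp_all add: r add_eq_0_iff2)
  then have "r = smul z p0" unfolding r p0_def by (cases u; cases v; cases w) (simp add: algebra_simps)
  then show ?thesis by (rule that)
qed

text \<open>The quotient of \<open>X\<close> by \<open>E\<close> is the affine coordinate of a line
  through the vertex, with \<open>E = 0\<close> as its infinite value. This form makes no mention of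
  a base, so pencils can be compared through subsets of the field.\<close>

definition Pen :: "'a set \<Rightarrow> 'a vec3 set set" where
  "Pen l = {pt r | r. r \<noteq> (0, 0, 0) \<and> (dot3 E r = 0 \<or> dot3 X r / dot3 E r \<in> l)}"

lemma pt_in_Pen:
  assumes "r \<noteq> (0, 0, 0)"
  shows "pt r \<in> Pen l \<longleftrightarrow> dot3 E r = 0 \<or> dot3 X r / dot3 E r \<in> l"
proof
  assume "pt r \<in> Pen l"
  then obtain s where s: "pt s = pt r" "s \<noteq> (0, 0, 0)" "dot3 E s = 0 \<or> dot3 X s / dot3 E s \<in> l"
    unfolding Pen_def by (smt (verit) mem_Collect_eq)
  then obtain c where "c \<noteq> 0" "r = smul c s" using pt_eq_pt_iff[OF s(2) assms] by blast
  then show "dot3 E r = 0 \<or> dot3 X r / dot3 E r \<in> l" using s(3) by simp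
next
  assume "dot3 E r = 0 \<or> dot3 X r / dot3 E r \<in> l"
  then show "pt r \<in> Pen l" unfolding Pen_def using assms by blast
qed

text \<open>The point \<open>x u + v\<close> has quotient \<open>x\<close>, so every field element
  can be tested for membership.\<close>

lemma Pen_inject: "Pen l = Pen l' \<longleftrightarrow> l = l'"
proof
  assume eq: "Pen l = Pen l'"
  have "vadd (smul x u) v \<noteq> (0, 0, 0)" for x
  proof
    assume "vadd (smul x u) v = (0, 0, 0)"
    then have "dot3 E (vadd (smul x u) v) = 0" by simp
    then show False by simp
  qed
  then have "x \<in> l \<longleftrightarrow> pt (vadd (smul x u) v) \<in> Pen l" for x l
    by (simp add: pt_in_Pen)
  then show "l = l'" using eq by blast
qed simp

lemma join_P:
  assumes "dot3 X r \<noteq> 0 \<or> dot3 E r \<noteq> 0"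
  shows "join P (pt r) = line_of (vadd (smul (dot3 E r) X) (smul (- dot3 X r) E))"
proof (rule join_eqI)
  \<comment> \<open>This combination of \<open>X\<close> and \<open>E\<close> vanishes at
    \<open>r\<close> by construction and at the vertex because both covectors do.\<close>
  let ?n = "vadd (smul (dot3 E r) X) (smul (- dot3 X r) E)"
  have r: "r \<noteq> (0, 0, 0)" using assms by auto
  have "?n \<noteq> (0, 0, 0)"
  proof
    assume n: "?n = (0, 0, 0)"
    have "dot3 ?n u = 0" "dot3 ?n v = 0" unfolding n by simp_all
    then show False using assms by simp
  qed
  then show "line_of ?n \<in> pg_lines" by (rule line_of_in_pg_lines)
  show "P \<in> line_of ?n" by simp
  show "pt r \<in> line_of ?n" using r by simp
  show "P \<noteq> pt r" using pt_eq_pt_iff[OF p0_nz r] assms by auto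
qed

text \<open>The base point with parameters \<open>s\<close>, \<open>t\<close> and
  \<open>t \<noteq> 0\<close> is joined to the vertex by the line where \<open>X / E\<close> is an
  affine function of \<open>s / t\<close>. The base point \<open>r0\<close> contributes the line at
  infinity.\<close>

lemma pencil_union:
  assumes r0: "dot3 E r0 = 0" "dot3 X r0 \<noteq> 0" and r1: "dot3 E r1 \<noteq> 0"
  shows "\<Union> (join P ` {pt (vadd (smul s r0) (smul t r1)) | s t. s \<in> K \<and> t \<in> K \<and> (s, t) \<noteq> (0, 0)})
    = Pen (aff (dot3 X r0 / dot3 E r1) (dot3 X r1 / dot3 E r1))"
    (is "\<Union> (join P ` ?b) = Pen (aff ?c ?d)")
proof -
  have j: "join P (pt (vadd (smul s r0) (smul t r1))) =
      line_of (vadd (smul (t * dot3 E r1) X) (smul (- (s * dot3 X r0 + t * dot3 X r1)) E))"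
    if "(s, t) \<noteq> (0, 0)" for s t
  proof -
    have "dot3 X (vadd (smul s r0) (smul t r1)) \<noteq> 0 \<or> dot3 E (vadd (smul s r0) (smul t r1)) \<noteq> 0"
      using that assms by auto
    from join_P[OF this] show ?thesis using r0 by simp
  qed
  have mem: "pt y \<in> \<Union> (join P ` ?b) \<longleftrightarrow> (\<exists>s t. s \<in> K \<and> t \<in> K \<and> (s, t) \<noteq> (0, 0) \<and>
      t * dot3 E r1 * dot3 X y = (s * dot3 X r0 + t * dot3 X r1) * dot3 E y)"
    (is "_ \<longleftrightarrow> ?M y") if y: "y \<noteq> (0, 0, 0)" for y
  proof -
    have "pt y \<in> join P (pt (vadd (smul s r0) (smul t r1))) \<longleftrightarrow>
        t * dot3 E r1 * dot3 X y = (s * dot3 X r0 + t * dot3 X r1) * dot3 E y" if "(s, t) \<noteq> (0, 0)" for s t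
      unfolding j[OF that] using y by (simp add: algebra_simps)
    then show ?thesis by blast
  qed
  have M: "?M y \<longleftrightarrow> dot3 E y = 0 \<or> dot3 X y / dot3 E y \<in> aff ?c ?d" for y
  proof
    assume "?M y"
    then obtain s t where st: "s \<in> K" "t \<in> K" "(s, t) \<noteq> (0, 0)"
      "t * dot3 E r1 * dot3 X y = (s * dot3 X r0 + t * dot3 X r1) * dot3 E y" by blast
    show "dot3 E y = 0 \<or> dot3 X y / dot3 E y \<in> aff ?c ?d"
    proof (cases "dot3 E y = 0")
      case False
      then have "t \<noteq> 0" using st r0 by auto
      then have "dot3 X y / dot3 E y = ?c * (s / t) + ?d"
        using st(4) False r1 by (simp add: field_simps)
      then show ?thesis using st K_divide unfolding aff_def by blast
    qed simp
  next
    assume *: "dot3 E y = 0 \<or> dot3 X y / dot3 E y \<in> aff ?c ?d"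
    show "?M y"
    proof (cases "dot3 E y = 0")
      case True
      \<comment> \<open>The parameters \<open>(1, 0)\<close> belong to \<open>r0\<close>, whose join
        with the vertex is \<open>E = 0\<close>.\<close>
      then show ?thesis by (intro exI[of _ 1] exI[of _ 0]) simp
    next
      case False
      then obtain k where "k \<in> K" "dot3 X y / dot3 E y = ?c * k + ?d"
        using * unfolding aff_def by blast
      then show ?thesis using False r1
        by (intro exI[of _ k] exI[of _ 1]) (simp add: field_simps)
    qed
  qed
  have sub: "\<Union> (join P ` ?b) \<subseteq> pg_points"
    using j line_of_subset by blast
  show ?thesis
  proof (intro set_eqI iffI)
    fix R assume R: "R \<in> \<Union> (join P ` ?b)"
    then obtain y where "y \<noteq> (0, 0, 0)" "R = pt y" using sub pg_pointsE by blast
    then show "R \<in> Pen (aff ?c ?d)" using R mem M pt_in_Pen by simp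
  next
    fix R assume R: "R \<in> Pen (aff ?c ?d)"
    then obtain y where "y \<noteq> (0, 0, 0)" "R = pt y" unfolding Pen_def by blast
    then show "R \<in> \<Union> (join P ` ?b)" using R mem M pt_in_Pen by simp
  qed
qed

end

lemma vadd_eq_zero_imp_cross3:
  assumes "vadd (smul s a) (smul t b) = (0, 0, 0)" "cross3 a b \<noteq> (0, 0, 0)"
  shows "s = 0 \<and> t = 0"
proof -
  have "smul s (cross3 a b) = cross3 (vadd (smul s a) (smul t b)) b"
    "smul t (cross3 a b) = cross3 a (vadd (smul s a) (smul t b))"
    by (cases a; cases b; simp add: algebra_simps)+
  then have "smul s (cross3 a b) = (0, 0, 0)" "smul t (cross3 a b) = (0, 0, 0)"
    unfolding assms(1) by (cases a; cases b; simp)+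
  then show ?thesis using assms(2) by simp
qed

section \<open>Baer sublines as bases of pencils\<close>

context quadratic_extension
begin

definition subline :: "'a vec3 \<Rightarrow> 'a vec3 \<Rightarrow> 'a vec3 set set" where
  "subline a b = {pt (vadd (smul s a) (smul t b)) | s t. s \<in> K \<and> t \<in> K \<and> (s, t) \<noteq> (0, 0)}"

lemma subline_commute: "subline a b = subline b a"
proof -
  have "vadd (smul s a) (smul t b) = vadd (smul t b) (smul s a)" for s t
    by (cases a; cases b) (simp add: algebra_simps)
  then show ?thesis unfolding subline_def by (metis (lifting) prod.inject)
qed

text \<open>A triangular change of basis over \<open>K\<close>. It allows the base point at infinity
  to be taken as one of the two generators.\<close>

lemma subline_rebase:
  assumes "s0 \<in> K" "t0 \<in> K" "s0 \<noteq> 0"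
  shows "subline (vadd (smul s0 a) (smul t0 b)) b = subline a b"
proof -
  have eq: "vadd (smul s (vadd (smul s0 a) (smul t0 b))) (smul t b)
      = vadd (smul (s * s0) a) (smul (s * t0 + t) b)" for s t
    by (cases a; cases b) (simp add: algebra_simps)
  show ?thesis
  proof (intro set_eqI iffI)
    fix R assume "R \<in> subline (vadd (smul s0 a) (smul t0 b)) b"
    then obtain s t where st: "s \<in> K" "t \<in> K" "(s, t) \<noteq> (0, 0)"
      "R = pt (vadd (smul (s * s0) a) (smul (s * t0 + t) b))"
      unfolding subline_def eq by blast
    then have "s * s0 \<in> K" "s * t0 + t \<in> K" "(s * s0, s * t0 + t) \<noteq> (0, 0)"
      using assms K_closed by auto
    then show "R \<in> subline a b" unfolding subline_def st(4) by blast
  next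
    fix R assume "R \<in> subline a b"
    then obtain s t where st: "s \<in> K" "t \<in> K" "(s, t) \<noteq> (0, 0)"
      "R = pt (vadd (smul s a) (smul t b))"
      unfolding subline_def by blast
    let ?s = "s / s0" and ?t = "t - s / s0 * t0"
    have "?s \<in> K" "?t \<in> K" "(?s, ?t) \<noteq> (0, 0)" using assms st K_closed by auto
    moreover have "R = pt (vadd (smul (?s * s0) a) (smul (?s * t0 + ?t) b))"
      using assms st by simp
    ultimately show "R \<in> subline (vadd (smul s0 a) (smul t0 b)) b"
      unfolding subline_def eq by blast
  qed
qed

lemma baer_subline_iff:
  "baer_subline q b \<longleftrightarrow> (\<exists>u w. u \<noteq> (0, 0, 0) \<and> w \<noteq> (0, 0, 0) \<and> pt u \<noteq> pt w \<and> b = subline u w)"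
  unfolding baer_subline_def subline_def K_def[symmetric] by (rule refl)

lemma subline_ends: "pt a \<in> subline a b" "pt b \<in> subline a b"
proof -
  have "pt (vadd (smul 1 a) (smul 0 b)) \<in> subline a b"
    unfolding subline_def mem_Collect_eq by (intro exI[of _ 1] exI[of _ 0]) simp
  moreover have "pt (vadd (smul 0 a) (smul 1 b)) \<in> subline a b"
    unfolding subline_def mem_Collect_eq by (intro exI[of _ 0] exI[of _ 1]) simp
  moreover have "vadd (smul 1 a) (smul 0 b) = a" "vadd (smul 0 a) (smul 1 b) = b"
    by (cases a; cases b; simp)+
  ultimately show "pt a \<in> subline a b" "pt b \<in> subline a b"
    by simp_all
qed

end

context baer_frame
begin

lemma pencil_subline:
  assumes "dot3 E r0 = 0" "dot3 X r0 \<noteq> 0" "dot3 E r1 \<noteq> 0"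
  shows "\<Union> (join P ` subline r0 r1) = Pen (aff (dot3 X r0 / dot3 E r1) (dot3 X r1 / dot3 E r1))"
  unfolding subline_def by (rule pencil_union[OF assms])

text \<open>The base is generated by its point \<open>r0\<close> at infinity and a point
  \<open>r1\<close> off the line at infinity, after which \<open>pencil_subline\<close> applies. No
  base point is a common zero of \<open>X\<close> and \<open>E\<close>, since the line of the base
  misses the vertex.\<close>

lemma linf_baer_pencilD:
  assumes "linf_baer_pencil q linf P \<Pi>"
  obtains c d where "c \<noteq> 0" "\<Pi> = Pen (aff c d)"
proof -
  obtain b where b: "baer_pencil q P b \<Pi>" "card (b \<inter> linf) = 1"
    using assms unfolding linf_baer_pencil_def by blast
  then obtain a a' where a: "a \<noteq> (0, 0, 0)" "a' \<noteq> (0, 0, 0)" "pt a \<noteq> pt a'" "b = subline a a'"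
    and Pm: "\<forall>m\<in>pg_lines. b \<subseteq> m \<longrightarrow> P \<notin> m" and \<Pi>: "\<Pi> = \<Union> (join P ` b)"
    unfolding baer_pencil_def baer_subline_iff by blast
  let ?n = "cross3 a a'"
  have n: "?n \<noteq> (0, 0, 0)" using cross3_eq_zero_iff a by blast
  have nz: "vadd (smul s a) (smul t a') \<noteq> (0, 0, 0)" if "(s, t) \<noteq> (0, 0)" for s t
    using vadd_eq_zero_imp_cross3[OF _ n] that by blast
  have n0: "dot3 ?n (vadd (smul s a) (smul t a')) = 0" for s t
    by (simp only: dot3_vadd dot3_smul) (simp add: dot3_cross3)
  have "b \<subseteq> line_of ?n"
    using nz n0 unfolding a(4) subline_def by auto
  then have nP: "dot3 ?n p0 \<noteq> 0"
    using Pm line_of_in_pg_lines[OF n] pt_in_line_of[OF p0_nz] by blast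
  have XE: "dot3 X (vadd (smul s a) (smul t a')) \<noteq> 0 \<or> dot3 E (vadd (smul s a) (smul t a')) \<noteq> 0"
    if "(s, t) \<noteq> (0, 0)" for s t
  proof (rule ccontr)
    assume "\<not> ?thesis"
    then obtain c where c: "vadd (smul s a) (smul t a') = smul c p0" using XE_zeroE by blast
    then have "c * dot3 ?n p0 = 0" using n0[of s t] by (simp only: dot3_smul)
    then show False using nP c nz[OF that] by simp
  qed
  obtain R where "R \<in> b \<inter> linf" using b(2) by (metis card.empty equals0I zero_neq_one)
  then obtain s0 t0 where st: "s0 \<in> K" "t0 \<in> K" "(s0, t0) \<noteq> (0, 0)"
    "pt (vadd (smul s0 a) (smul t0 a')) \<in> line_of E"
    unfolding a(4) subline_def linf_eq by blast
  define r0 where "r0 = vadd (smul s0 a) (smul t0 a')"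
  have r0: "dot3 E r0 = 0" "dot3 X r0 \<noteq> 0"
    using pt_in_line_of[OF nz[OF st(3)]] st(4) XE[OF st(3)] unfolding r0_def by auto
  \<comment> \<open>Otherwise the line of the base would be the line at infinity, which contains the
    vertex.\<close>
  have notE: "\<not> (dot3 E a = 0 \<and> dot3 E a' = 0)"
  proof
    assume "dot3 E a = 0 \<and> dot3 E a' = 0"
    then have "line_of E = line_of ?n" using line_of_two_points[OF E_nz _ _ n] by blast
    moreover have "P \<in> line_of E" "P \<notin> line_of ?n" using nP by simp_all
    ultimately show False by blast
  qed
  \<comment> \<open>The point \<open>r0\<close> replaces whichever of the two generators has a
    nonzero coefficient in it; the other generator becomes \<open>r1\<close>.\<close>
  have "\<exists>r1. b = subline r0 r1 \<and> dot3 E r1 \<noteq> 0"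
  proof (cases "s0 = 0")
    case False
    then have "b = subline r0 a'" using subline_rebase[OF st(1,2)] a r0_def by simp
    moreover have "dot3 E a' \<noteq> 0" using notE r0(1) False by (auto simp: r0_def)
    ultimately show ?thesis by blast
  next
    case True
    then have t0: "t0 \<noteq> 0" using st by simp
    have "r0 = vadd (smul t0 a') (smul s0 a)"
      unfolding r0_def by (cases a; cases a') (simp add: algebra_simps)
    then have "b = subline r0 a"
      using subline_rebase[OF st(2,1) t0] a subline_commute by simp
    moreover have "dot3 E a \<noteq> 0" using notE r0(1) t0 by (auto simp: r0_def True)
    ultimately show ?thesis by blast
  qed
  then obtain r1 where r1: "b = subline r0 r1" "dot3 E r1 \<noteq> 0" by blast
  have "\<Pi> = Pen (aff (dot3 X r0 / dot3 E r1) (dot3 X r1 / dot3 E r1))"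
    unfolding \<Pi> r1(1) by (rule pencil_subline[OF r0 r1(2)])
  moreover have "dot3 X r0 / dot3 E r1 \<noteq> 0" using r0 r1 by simp
  ultimately show ?thesis using that by blast
qed

lemma linf_baer_pencilI:
  assumes "c \<noteq> 0"
  shows "linf_baer_pencil q linf P (Pen (aff c d))"
proof -
  \<comment> \<open>Generators whose values under \<open>E\<close> and \<open>X\<close> reproduce
    \<open>c\<close> and \<open>d\<close> in the formula of \<open>pencil_subline\<close>.\<close>
  let ?a = "smul c u" and ?b = "vadd (smul d u) v"
  have a: "dot3 E ?a = 0" "dot3 X ?a = c" and b: "dot3 E ?b = 1" "dot3 X ?b = d" by simp_all
  have nz: "?a \<noteq> (0, 0, 0)" "?b \<noteq> (0, 0, 0)" using assms b(1) by (simp, metis dot3_zero zero_neq_one)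
  have ne: "pt ?a \<noteq> pt ?b"
  proof
    assume "pt ?a = pt ?b"
    then obtain k where "?b = smul k ?a" using pt_eq_pt_iff[OF nz] by blast
    then have "dot3 E ?b = dot3 E (smul k ?a)" by simp
    then show False by simp
  qed
  have "Pen (aff c d) = \<Union> (join P ` subline ?a ?b)"
    using pencil_subline[of ?a ?b] assms by simp
  moreover have "baer_subline q (subline ?a ?b)"
    unfolding baer_subline_iff using nz ne by blast
  moreover have "P \<notin> m" if m: "m \<in> pg_lines" "subline ?a ?b \<subseteq> m" for m
  proof
    assume "P \<in> m"
    obtain n where n: "n \<noteq> (0, 0, 0)" "m = line_of n" using m(1) by (rule pg_linesE)
    have "pt ?a \<in> line_of n" "pt ?b \<in> line_of n" using subline_ends m n by blast+
    then have "dot3 n ?a = 0" "dot3 n ?b = 0" using nz pt_in_line_of by blast+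
    moreover have "dot3 n p0 = 0" using \<open>P \<in> m\<close> n by simp
    ultimately have "dot3 n u = 0" "dot3 n v = 0" "dot3 n w = 0"
      using assms by (auto simp: p0_def)
    then show False using covector_eq_zero[OF indep] n by blast
  qed
  ultimately have "baer_pencil q P (subline ?a ?b) (Pen (aff c d))"
    unfolding baer_pencil_def using pt_in_pg_points[OF p0_nz] by blast
  moreover have "subline ?a ?b \<inter> linf = {pt u}"
  proof (intro set_eqI iffI)
    fix R assume "R \<in> subline ?a ?b \<inter> linf"
    then obtain s t where st: "(s, t) \<noteq> (0, 0)" "R = pt (vadd (smul s ?a) (smul t ?b))" "R \<in> line_of E"
      unfolding subline_def linf_eq by blast
    let ?r = "vadd (smul s ?a) (smul t ?b)"
    have "dot3 E ?r = t" "dot3 X ?r = s * c + t * d" by simp_all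
    then have "?r \<noteq> (0, 0, 0)" using st(1) assms by (metis add.right_neutral dot3_zero mult_eq_0_iff)
    then have "t = 0" using st by simp
    then have "?r = smul (s * c) u" "s * c \<noteq> 0"
      using st(1) assms by (cases u; cases v; simp)+
    then have "R = pt u" using st(2) by (simp del: smul_smul)
    then show "R \<in> {pt u}" by simp
  next
    fix R assume "R \<in> {pt u}"
    moreover have "pt ?a = pt u" using assms by simp
    then have "pt u \<in> subline ?a ?b" using subline_ends(1)[of ?a ?b] by simp
    ultimately show "R \<in> subline ?a ?b \<inter> linf" by (simp add: linf_eq)
  qed
  moreover have "P \<in> linf" by (simp add: linf_eq)
  ultimately show ?thesis unfolding linf_baer_pencil_def by auto
qed

lemma linf_baer_pencil_iff:
  "linf_baer_pencil q linf P \<Pi> \<longleftrightarrow> (\<exists>g. g \<noteq> 0 \<and> (\<Pi> = Pen (aff g 0) \<or> \<Pi> = Pen (aff g (g * \<theta>))))"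
proof
  assume "linf_baer_pencil q linf P \<Pi>"
  then obtain c d where "c \<noteq> 0" "\<Pi> = Pen (aff c d)" by (rule linf_baer_pencilD)
  then show "\<exists>g. g \<noteq> 0 \<and> (\<Pi> = Pen (aff g 0) \<or> \<Pi> = Pen (aff g (g * \<theta>)))"
    using aff_cases by metis
qed (use linf_baer_pencilI in blast)

end

section \<open>Pencils meeting the subplane\<close>

context quadratic_extension
begin

text \<open>Together with \<open>im\<close>, the coordinate for the \<open>K\<close>-basis 1,
  \<open>\<theta>\<close>; by \<open>repr_unique\<close> the choice is forced.\<close>

definition re :: "'a \<Rightarrow> 'a" where "re x = (SOME m. m \<in> K \<and> (\<exists>n\<in>K. x = m + n * \<theta>))"

definition im :: "'a \<Rightarrow> 'a" where "im x = (x - re x) / \<theta>"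

lemma re_im: "re x \<in> K" "im x \<in> K" "re x + im x * \<theta> = x"
proof -
  obtain m n where "m \<in> K" "n \<in> K" "x = m + n * \<theta>" by (rule repr_exists)
  then have ex: "\<exists>m. m \<in> K \<and> (\<exists>n\<in>K. x = m + n * \<theta>)" by blast
  have "\<theta> \<noteq> 0" using \<theta> K_zero by metis
  obtain n where n: "re x \<in> K" "n \<in> K" "x = re x + n * \<theta>"
    using someI_ex[OF ex] unfolding re_def by blast
  then have "im x = n" unfolding im_def using \<open>\<theta> \<noteq> 0\<close> by (metis add_diff_cancel_left' nonzero_mult_div_cancel_right)
  then show "re x \<in> K" "im x \<in> K" "re x + im x * \<theta> = x" using n by simp_all
qed

lemma re_im_eqI:
  assumes "m \<in> K" "n \<in> K" "x = m + n * \<theta>"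
  shows "re x = m" "im x = n"
  using repr_unique[of "re x" "im x" m n] re_im assms by auto

lemma re_im_lin:
  assumes "a \<in> K" "b \<in> K"
  shows "re (a * x + b * y) = a * re x + b * re y" "im (a * x + b * y) = a * im x + b * im y"
proof -
  have "a * x + b * y = a * (re x + im x * \<theta>) + b * (re y + im y * \<theta>)" by (simp add: re_im)
  also have "\<dots> = (a * re x + b * re y) + (a * im x + b * im y) * \<theta>" by (simp add: algebra_simps)
  finally have eq: "a * x + b * y = (a * re x + b * re y) + (a * im x + b * im y) * \<theta>" .
  have "a * re x + b * re y \<in> K" "a * im x + b * im y \<in> K"
    using assms by (simp_all add: K_closed re_im)
  then show "re (a * x + b * y) = a * re x + b * re y" "im (a * x + b * y) = a * im x + b * im y"
    using re_im_eqI[OF _ _ eq] by blast+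
qed

end

section \<open>Points and lines of the subplane in the coordinates X and E\<close>

context baer_frame
begin

text \<open>For \<open>x\<close> in \<open>K\<close> this inverts the pair of covectors
  \<open>X\<close>, \<open>E\<close> on the \<open>K\<close>-span of \<open>u\<close>,
  \<open>v\<close>, \<open>w\<close>.\<close>

definition vec :: "'a \<Rightarrow> 'a \<Rightarrow> 'a vec3" where
  "vec x \<eta> = lc u v w x (re \<eta>) (im \<eta>)"

lemma dot3_vec [simp]: "dot3 X (vec x \<eta>) = x" "dot3 E (vec x \<eta>) = \<eta>"
  by (simp_all add: vec_def re_im)

lemma vec_lin:
  assumes "a \<in> K" "b \<in> K"
  shows "vec (a * x + b * y) (a * \<eta> + b * \<zeta>) = vadd (smul a (vec x \<eta>)) (smul b (vec y \<zeta>))"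
  unfolding vec_def re_im_lin[OF assms] by (cases u; cases v; cases w) (simp add: algebra_simps)

lemma vec_smul: "a \<in> K \<Longrightarrow> vec (a * x) (a * \<eta>) = smul a (vec x \<eta>)"
  using vec_lin[of a 0 x x \<eta> \<eta>] by (cases "vec x \<eta>") simp

lemma vec_basis: "vec 1 0 = u" "vec 0 1 = v" "vec 0 \<theta> = w"
proof -
  have "re 0 = 0" "im 0 = 0" "re 1 = 1" "im 1 = 0" "re \<theta> = 0" "im \<theta> = 1"
    using re_im_eqI[of 0 0 0] re_im_eqI[of 1 0 1] re_im_eqI[of 0 1 \<theta>] by simp_all
  then show "vec 1 0 = u" "vec 0 1 = v" "vec 0 \<theta> = w"
    unfolding vec_def by (cases u; cases v; cases w; simp)+
qed

lemma vec_nz: "(x, \<eta>) \<noteq> (0, 0) \<Longrightarrow> vec x \<eta> \<noteq> (0, 0, 0)"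
  by (metis dot3_vec dot3_zero)

lemma mem_B_iff: "R \<in> B \<longleftrightarrow> (\<exists>x \<eta>. x \<in> K \<and> (x, \<eta>) \<noteq> (0, 0) \<and> R = pt (vec x \<eta>))"
proof
  assume "R \<in> B"
  then obtain x y z where xyz: "x \<in> K" "y \<in> K" "z \<in> K" "(x, y, z) \<noteq> (0, 0, 0)" "R = pt (lc u v w x y z)"
    unfolding B_eq by blast
  have "re (y + z * \<theta>) = y" "im (y + z * \<theta>) = z" using re_im_eqI[OF xyz(2,3) refl] by simp_all
  then have "R = pt (vec x (y + z * \<theta>))" using xyz by (simp add: vec_def)
  moreover have "(x, y + z * \<theta>) \<noteq> (0, 0)" using xyz repr_zero_iff by auto
  ultimately show "\<exists>x \<eta>. x \<in> K \<and> (x, \<eta>) \<noteq> (0, 0) \<and> R = pt (vec x \<eta>)" using xyz by blast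
next
  assume "\<exists>x \<eta>. x \<in> K \<and> (x, \<eta>) \<noteq> (0, 0) \<and> R = pt (vec x \<eta>)"
  then obtain x \<eta> where x: "x \<in> K" "(x, \<eta>) \<noteq> (0, 0)" "R = pt (vec x \<eta>)" by blast
  have "(x, re \<eta>, im \<eta>) \<noteq> (0, 0, 0)" using x(2) re_im(3)[of \<eta>] by auto
  then show "R \<in> B" unfolding B_eq using x re_im unfolding vec_def by blast
qed

lemma vec_in_B: "x \<in> K \<Longrightarrow> (x, \<eta>) \<noteq> (0, 0) \<Longrightarrow> pt (vec x \<eta>) \<in> B"
  using mem_B_iff by blast

lemma pt_vec_in_Pen: "(x, \<eta>) \<noteq> (0, 0) \<Longrightarrow> pt (vec x \<eta>) \<in> Pen l \<longleftrightarrow> \<eta> = 0 \<or> x / \<eta> \<in> l"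
  using pt_in_Pen[OF vec_nz] by simp

text \<open>Since \<open>h\<close> and \<open>\<theta> * h\<close> form a \<open>K\<close>-basis of
  the field, the two vectors span the same plane as \<open>v\<close> and \<open>w\<close>.\<close>

lemma covector_vec:
  assumes "dot3 n u = 0" "h \<noteq> 0" "dot3 n (vec 0 h) = 0" "dot3 n (vec 0 (\<theta> * h)) = 0"
  shows "n = (0, 0, 0)"
proof -
  have "dot3 n (vec 0 \<eta>) = 0" for \<eta>
  proof -
    have "\<eta> = (re (\<eta> / h) + im (\<eta> / h) * \<theta>) * h" using assms(2) by (simp add: re_im)
    then have "\<eta> = re (\<eta> / h) * h + im (\<eta> / h) * (\<theta> * h)" by (simp add: algebra_simps)
    then have "vec 0 \<eta> = vec (re (\<eta> / h) * 0 + im (\<eta> / h) * 0) (re (\<eta> / h) * h + im (\<eta> / h) * (\<theta> * h))"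
      by simp
    also have "\<dots> = vadd (smul (re (\<eta> / h)) (vec 0 h)) (smul (im (\<eta> / h)) (vec 0 (\<theta> * h)))"
      by (rule vec_lin) (rule re_im)+
    finally show ?thesis using assms by simp
  qed
  then have "dot3 n v = 0" "dot3 n w = 0" using vec_basis by metis+
  then show ?thesis using covector_eq_zero[OF indep] assms(1) by blast
qed

lemma dot3_vec_split: "x \<in> K \<Longrightarrow> dot3 n (vec x \<eta>) = x * dot3 n u + dot3 n (vec 0 \<eta>)"
  using vec_lin[of x 1 1 0 0 \<eta>] vec_basis(1) by simp

lemma b_lineI:
  assumes "m \<in> pg_lines" "R \<in> m \<inter> B" "R' \<in> m \<inter> B" "R \<noteq> R'"
  shows "b_line q B (m \<inter> B)"
proof -
  have "card (m \<inter> B) \<ge> 2" using assms by (intro card_ge_2I) simp_all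
  then have "card (m \<inter> B) = q + 1" using subplane assms(1) unfolding baer_subplane_def by blast
  then show ?thesis unfolding b_line_def using assms(1) by blast
qed

text \<open>The line \<open>X = 0\<close> of \<open>B\<close>; its extension passes through the
  vertex.\<close>

definition LP :: "'a vec3 set set" where
  "LP = {pt (vec 0 \<eta>) | \<eta>. \<eta> \<noteq> 0}"

text \<open>For \<open>h \<noteq> 0\<close>, the line of \<open>B\<close> joining
  \<open>pt u\<close> to \<open>pt (vec 0 h)\<close>.\<close>

definition LT :: "'a \<Rightarrow> 'a vec3 set set" where
  "LT h = {pt (vec x (k * h)) | x k. x \<in> K \<and> k \<in> K \<and> (x, k) \<noteq> (0, 0)}"

lemma line_X: "line_of X \<inter> B = LP"
proof (intro set_eqI iffI)
  fix R assume R: "R \<in> line_of X \<inter> B"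
  then obtain x \<eta> where "x \<in> K" "(x, \<eta>) \<noteq> (0, 0)" "R = pt (vec x \<eta>)" using mem_B_iff by blast
  then show "R \<in> LP" using R vec_nz unfolding LP_def by auto
next
  fix R assume "R \<in> LP"
  then obtain \<eta> where "\<eta> \<noteq> 0" "R = pt (vec 0 \<eta>)" unfolding LP_def by blast
  then show "R \<in> line_of X \<inter> B" using vec_nz[of 0 \<eta>] vec_in_B[of 0 \<eta>] by simp
qed

lemma b_line_LP: "b_line q B LP" and P_in_line_X: "P \<in> line_of X"
proof -
  have "pt (vec 0 1) \<noteq> pt (vec 0 \<theta>)"
  proof
    assume "pt (vec 0 1) = pt (vec 0 \<theta>)"
    then have "cross3 v w = (0, 0, 0)"
      using vec_basis vec_nz[of 0 1] vec_nz[of 0 \<theta>] \<theta> K_zero by (metis cross3_eq_zero_iff prod.inject zero_neq_one)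
    then have "X = (0, 0, 0)" unfolding X_def by simp
    then show False by simp
  qed
  moreover have "\<theta> \<noteq> 0" using \<theta> K_zero by metis
  then have "pt (vec 0 1) \<in> LP" "pt (vec 0 \<theta>) \<in> LP" unfolding LP_def using one_neq_zero by blast+
  ultimately show "b_line q B LP"
    using b_lineI[OF line_of_in_pg_lines[OF X_nz]] unfolding line_X by blast
  show "P \<in> line_of X" by simp
qed

lemma T_notin_LP: "pt u \<notin> LP"
proof
  assume "pt u \<in> LP"
  then have "pt u \<in> line_of X" using line_X by blast
  then show False by simp
qed

lemma b_line_card: "b_line q B L \<Longrightarrow> card L = q + 1"
  unfolding b_line_def by blast

lemma b_line_two:
  assumes "b_line q B L"
  obtains R R' where "R \<in> L" "R' \<in> L" "R \<noteq> R'"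
  using card_ge_2E[of L] b_line_card[OF assms] two_le_q by auto

text \<open>A covector vanishing at the vertex is a combination \<open>a X + b E\<close>. If
  \<open>b \<noteq> 0\<close>, then \<open>\<eta>\<close> is a fixed multiple of \<open>x\<close>,
  so all points of \<open>L\<close> are \<open>K\<close>-proportional and coincide, although
  \<open>L\<close> has at least two points. Hence \<open>b = 0\<close> and \<open>L\<close> lies on
  \<open>X = 0\<close>; equal cardinalities finish the proof.\<close>

lemma b_line_P_unique:
  assumes L: "b_line q B L" and m: "m \<in> pg_lines" "L \<subseteq> m" "P \<in> m"
  shows "L = LP"
proof -
  obtain m' where m': "m' \<in> pg_lines" "L = m' \<inter> B" using L unfolding b_line_def by blast
  obtain R R' where R: "R \<in> L" "R' \<in> L" "R \<noteq> R'" using L by (rule b_line_two)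
  have "m = m'" by (rule pg_lines_eqI[OF m(1) m'(1), of R R']) (use R m m' in auto)
  then have LB: "L = m \<inter> B" using m' by simp
  obtain n where n: "n \<noteq> (0, 0, 0)" "m = line_of n" using m(1) by (rule pg_linesE)
  have "dot3 n p0 = 0" using m n by simp
  then have nw: "dot3 n w = \<theta> * dot3 n v" by (simp add: p0_def)
  let ?a = "dot3 n u" and ?b = "dot3 n v"
  have nvec: "dot3 n (vec x \<eta>) = ?a * x + ?b * \<eta>" for x \<eta>
  proof -
    have "dot3 n (vec x \<eta>) = ?a * x + ?b * (re \<eta> + im \<eta> * \<theta>)"
      by (simp add: vec_def nw algebra_simps)
    then show ?thesis by (simp add: re_im)
  qed
  have mem: "\<exists>x \<eta>. x \<in> K \<and> (x, \<eta>) \<noteq> (0, 0) \<and> R = pt (vec x \<eta>) \<and> ?a * x + ?b * \<eta> = 0" if "R \<in> L" for R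
  proof -
    have "R \<in> B" using that LB by simp
    then obtain x \<eta> where x: "x \<in> K" "(x, \<eta>) \<noteq> (0, 0)" "R = pt (vec x \<eta>)" using mem_B_iff by blast
    then have "?a * x + ?b * \<eta> = 0" using that vec_nz[OF x(2)] nvec n LB by simp
    then show ?thesis using x by blast
  qed
  obtain x \<eta> where x: "x \<in> K" "(x, \<eta>) \<noteq> (0, 0)" "R = pt (vec x \<eta>)" "?a * x + ?b * \<eta> = 0"
    using mem[OF R(1)] by blast
  obtain x' \<eta>' where x': "x' \<in> K" "(x', \<eta>') \<noteq> (0, 0)" "R' = pt (vec x' \<eta>')" "?a * x' + ?b * \<eta>' = 0"
    using mem[OF R(2)] by blast
  have b: "?b = 0"
  proof (rule ccontr)
    assume b: "?b \<noteq> 0"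
    then have \<eta>: "\<eta> = - ?a / ?b * x" "\<eta>' = - ?a / ?b * x'"
      using x(4) x'(4) by (simp_all add: field_simps add_eq_0_iff)
    have nz: "x \<noteq> 0" "x' \<noteq> 0" using x(2) x'(2) unfolding \<eta> by auto
    define k where "k = x' / x"
    have "k \<in> K" "k \<noteq> 0" "x' = k * x" "\<eta>' = k * \<eta>" using x(1) x'(1) nz K_divide \<eta> by (simp_all add: k_def)
    then have "R' = R" using x(3) x'(3) vec_smul by simp
    then show False using R by simp
  qed
  have a: "?a \<noteq> 0"
    using covector_eq_zero[OF indep, of n] n(1) nw b by auto
  have "L \<subseteq> LP"
  proof
    fix R assume "R \<in> L"
    then obtain x \<eta> where "(x, \<eta>) \<noteq> (0, 0)" "R = pt (vec x \<eta>)" "?a * x + ?b * \<eta> = 0"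
      using mem[OF \<open>R \<in> L\<close>] by blast
    then show "R \<in> LP" using a b unfolding LP_def by auto
  qed
  moreover have "card L = card LP" using b_line_card L b_line_LP by simp
  ultimately show ?thesis using card_subset_eq[of LP L] by simp
qed

text \<open>Expand \<open>\<eta>\<close> in the \<open>K\<close>-basis \<open>h\<close>,
  \<open>\<theta> * h\<close>. By \<open>covector_vec\<close> the nonzero \<open>n\<close> cannot
  vanish at \<open>vec 0 (\<theta> * h)\<close>, so incidence forces the second coefficient to be
  0.\<close>

lemma line_through_T:
  assumes "n \<noteq> (0, 0, 0)" "dot3 n u = 0" "h \<noteq> 0" "dot3 n (vec 0 h) = 0"
  shows "line_of n \<inter> B = LT h"
proof (intro set_eqI iffI)
  fix R assume "R \<in> LT h"
  then obtain x k where x: "x \<in> K" "k \<in> K" "(x, k) \<noteq> (0, 0)" "R = pt (vec x (k * h))"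
    unfolding LT_def by blast
  have nz: "(x, k * h) \<noteq> (0, 0)" using x(3) assms(3) by simp
  have "vec 0 (k * h) = smul k (vec 0 h)" using vec_smul[OF x(2), of 0 h] by simp
  then have "dot3 n (vec x (k * h)) = 0" using dot3_vec_split[OF x(1)] assms by simp
  then show "R \<in> line_of n \<inter> B" using x nz vec_nz[OF nz] vec_in_B[OF x(1) nz] by simp
next
  fix R assume R: "R \<in> line_of n \<inter> B"
  then obtain x \<eta> where x: "x \<in> K" "(x, \<eta>) \<noteq> (0, 0)" "R = pt (vec x \<eta>)" using mem_B_iff by blast
  have "dot3 n (vec x \<eta>) = 0" using R x vec_nz by simp
  then have n\<eta>: "dot3 n (vec 0 \<eta>) = 0" using dot3_vec_split[OF x(1)] assms by simp
  let ?a = "re (\<eta> / h)" and ?b = "im (\<eta> / h)"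
  have "\<eta> = (?a + ?b * \<theta>) * h" using assms(3) by (simp add: re_im)
  then have \<eta>: "\<eta> = ?a * h + ?b * (\<theta> * h)" by (simp add: algebra_simps)
  then have "vec 0 \<eta> = vec (?a * 0 + ?b * 0) (?a * h + ?b * (\<theta> * h))" by simp
  also have "\<dots> = vadd (smul ?a (vec 0 h)) (smul ?b (vec 0 (\<theta> * h)))"
    by (rule vec_lin) (rule re_im)+
  finally have "?b * dot3 n (vec 0 (\<theta> * h)) = 0" using n\<eta> assms by simp
  then have "?b = 0" using covector_vec[OF assms(2-4)] assms(1) by auto
  then have "\<eta> = ?a * h" using \<eta> by (metis add.right_neutral mult_zero_left)
  then obtain k where k: "k \<in> K" "\<eta> = k * h" using re_im(1) by blast
  then have "(x, k) \<noteq> (0, 0)" using x(2) by auto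
  then show "R \<in> LT h" unfolding LT_def using x(1,3) k by blast
qed

lemma T_in_LT: "pt u \<in> LT h"
proof -
  have "pt (vec 1 (0 * h)) \<in> LT h" unfolding LT_def mem_Collect_eq
    by (intro exI[of _ 1] exI[of _ 0]) simp
  then show ?thesis by (simp add: vec_basis)
qed

lemma LT_direction: "pt (vec 0 h) \<in> LT h"
proof -
  have "pt (vec 0 (1 * h)) \<in> LT h" unfolding LT_def mem_Collect_eq
    by (intro exI[of _ 0] exI[of _ 1]) simp
  then show ?thesis by simp
qed

lemma b_line_LT:
  assumes "h \<noteq> 0"
  shows "b_line q B (LT h)"
proof -
  let ?n = "cross3 u (vec 0 h)"
  have nz: "vec 0 h \<noteq> (0, 0, 0)" using vec_nz assms by simp
  have ne: "pt u \<noteq> pt (vec 0 h)"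
    using T_notin_LP assms unfolding LP_def by blast
  have n: "?n \<noteq> (0, 0, 0)" using cross3_eq_zero_iff[OF u_nz nz] ne by simp
  have L: "line_of ?n \<inter> B = LT h"
    by (rule line_through_T) (use n assms in \<open>simp_all add: dot3_cross3\<close>)
  show ?thesis
    using b_lineI[OF line_of_in_pg_lines[OF n]] T_in_LT LT_direction ne unfolding L by blast
qed

lemma b_line_T_cases:
  assumes "b_line q B L" "pt u \<in> L"
  obtains h where "h \<noteq> 0" "L = LT h"
proof -
  obtain m where m: "m \<in> pg_lines" "L = m \<inter> B" using assms(1) unfolding b_line_def by blast
  obtain n where n: "n \<noteq> (0, 0, 0)" "m = line_of n" using m(1) by (rule pg_linesE)
  \<comment> \<open>The value of \<open>E\<close> at any second point of \<open>L\<close> serves as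
    its direction \<open>h\<close>.\<close>
  obtain R where R: "R \<in> L" "R \<noteq> pt u" using b_line_two[OF assms(1)] by metis
  obtain x h where x: "x \<in> K" "(x, h) \<noteq> (0, 0)" "R = pt (vec x h)" using R m mem_B_iff by blast
  have "h \<noteq> 0"
  proof
    assume "h = 0"
    then have "vec x h = smul x u" "x \<noteq> 0" using vec_smul[OF x(1), of 1 0] vec_basis x(2) by auto
    then show False using R x by simp
  qed
  moreover have nu: "dot3 n u = 0" using assms m n by simp
  moreover have "dot3 n (vec x h) = 0" using R m n x vec_nz by simp
  then have "dot3 n (vec 0 h) = 0" using dot3_vec_split[OF x(1)] nu by simp
  ultimately have "line_of n \<inter> B = LT h" using line_through_T n by blast
  then show ?thesis using that \<open>h \<noteq> 0\<close> m n by simp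
qed

lemma Pen_aff_zero:
  assumes "g \<noteq> 0"
  shows "Pen (aff g 0) \<inter> B = LP \<union> LT (1 / g)"
proof (intro set_eqI iffI)
  fix R assume R: "R \<in> Pen (aff g 0) \<inter> B"
  then obtain x \<eta> where x: "x \<in> K" "(x, \<eta>) \<noteq> (0, 0)" "R = pt (vec x \<eta>)" using mem_B_iff by blast
  then have "\<eta> = 0 \<or> x / \<eta> \<in> aff g 0" using R pt_vec_in_Pen by blast
  then have "\<exists>k\<in>K. \<eta> = k * (1 / g)" if "x \<noteq> 0"
  proof
    assume "x / \<eta> \<in> aff g 0"
    then obtain k where k: "k \<in> K" "x / \<eta> = g * k" by (auto simp: aff_def)
    show ?thesis
    proof (cases "\<eta> = 0")
      case False
      then have "\<eta> = x / k * (1 / g)" using k(2) that assms by (auto simp: field_simps)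
      then show ?thesis using K_divide x k by blast
    qed (auto intro: bexI[of _ 0])
  qed (auto intro: bexI[of _ 0])
  then show "R \<in> LP \<union> LT (1 / g)"
    using x unfolding LP_def LT_def by (cases "x = 0") auto
next
  fix R assume "R \<in> LP \<union> LT (1 / g)"
  then show "R \<in> Pen (aff g 0) \<inter> B"
  proof
    assume "R \<in> LP"
    then show ?thesis using pt_vec_in_Pen[of 0] vec_in_B[of 0] zero_in_aff unfolding LP_def by auto
  next
    assume "R \<in> LT (1 / g)"
    then obtain x k where x: "x \<in> K" "k \<in> K" "(x, k) \<noteq> (0, 0)" "R = pt (vec x (k * (1 / g)))"
      unfolding LT_def by blast
    have nz: "(x, k * (1 / g)) \<noteq> (0, 0)" using x(3) assms by simp
    \<comment> \<open>For \<open>k = 0\<close> both sides are 0 by the convention for division by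
      zero, so this point of \<open>LT\<close> causes no separate case.\<close>
    have "x / (k * (1 / g)) = g * (x / k) + 0" by simp
    then have "x / (k * (1 / g)) \<in> aff g 0" unfolding aff_def using x K_divide by blast
    then show ?thesis unfolding x(4) using vec_in_B[OF x(1) nz] pt_vec_in_Pen[OF nz] by blast
  qed
qed

lemma Pen_aff_theta_LP:
  assumes "g \<noteq> 0"
  shows "Pen (aff g (g * \<theta>)) \<inter> LP = {}"
  using zero_notin_aff_theta[OF assms] pt_vec_in_Pen[of 0] unfolding LP_def by auto

lemma T_in_B: "pt u \<in> B"
  using vec_in_B[of 1 0] vec_basis(1) by simp

lemma T_in_Pen: "pt u \<in> Pen l"
  by (simp add: pt_in_Pen)

text \<open>With \<open>\<theta>\<^sup>2 = A\<theta> + C\<close> and \<open>\<eta> = (t + s\<theta>) / g\<close>, comparing coordinates in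
  \<open>x = (k + \<theta>)(t + s\<theta>)\<close> and eliminating \<open>k\<close> leaves a single equation.\<close>

lemma conic_equation:
  assumes AC: "A \<in> K" "C \<in> K" "\<theta> * \<theta> = C + A * \<theta>" and g: "g \<noteq> 0"
    and str: "s \<in> K" "t \<in> K" "x \<in> K"
  shows "(t + s * \<theta>) / g = 0 \<or> x / ((t + s * \<theta>) / g) \<in> aff g (g * \<theta>)
    \<longleftrightarrow> s * (s * C - t * A - x) = t ^ 2"
proof (cases "t + s * \<theta> = 0")
  \<comment> \<open>Here \<open>s = t = 0\<close>, and both sides of the equivalence hold.\<close>
  case True
  then show ?thesis using repr_zero_iff str by simp
next
  case False
  have "x / ((t + s * \<theta>) / g) \<in> aff g (g * \<theta>) \<longleftrightarrow> (\<exists>k\<in>K. x = (k + \<theta>) * (t + s * \<theta>))"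
    unfolding aff_def image_iff
  proof (rule bex_cong[OF refl])
    fix k assume "k \<in> K"
    have "x / ((t + s * \<theta>) / g) = g * k + g * \<theta> \<longleftrightarrow> g * (x / (t + s * \<theta>)) = g * (k + \<theta>)"
      by (simp add: distrib_left mult.commute)
    also have "\<dots> \<longleftrightarrow> x / (t + s * \<theta>) = k + \<theta>" by (rule mult_left_cancel[OF g])
    also have "\<dots> \<longleftrightarrow> x = (k + \<theta>) * (t + s * \<theta>)" using False by (simp only: divide_eq_eq) simp
    finally show "x / ((t + s * \<theta>) / g) = g * k + g * \<theta> \<longleftrightarrow> x = (k + \<theta>) * (t + s * \<theta>)" .
  qed
  also have "\<dots> \<longleftrightarrow> (\<exists>k\<in>K. x = k * t + s * C \<and> 0 = t + k * s + s * A)"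
  proof (rule bex_cong[OF refl])
    fix k assume k: "k \<in> K"
    have "(k + \<theta>) * (t + s * \<theta>) = k * t + (t + k * s) * \<theta> + s * (\<theta> * \<theta>)"
      by (simp add: algebra_simps)
    also have "\<dots> = (k * t + s * C) + (t + k * s + s * A) * \<theta>"
      unfolding AC(3) by (simp add: algebra_simps)
    finally have "x = (k + \<theta>) * (t + s * \<theta>) \<longleftrightarrow> x + 0 * \<theta> = (k * t + s * C) + (t + k * s + s * A) * \<theta>"
      by simp
    also have "\<dots> \<longleftrightarrow> x = k * t + s * C \<and> 0 = t + k * s + s * A"
    proof
      assume "x + 0 * \<theta> = (k * t + s * C) + (t + k * s + s * A) * \<theta>"
      then show "x = k * t + s * C \<and> 0 = t + k * s + s * A"
        using str k AC by (intro repr_unique K_closed)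
    qed simp
    finally show "x = (k + \<theta>) * (t + s * \<theta>) \<longleftrightarrow> x = k * t + s * C \<and> 0 = t + k * s + s * A" .
  qed
  also have "\<dots> \<longleftrightarrow> s * (s * C - t * A - x) = t ^ 2"
  proof
    assume "\<exists>k\<in>K. x = k * t + s * C \<and> 0 = t + k * s + s * A"
    then obtain k where k: "x = k * t + s * C" "t + k * s + s * A = 0" by auto
    have "s * (s * C - t * A - x) = t ^ 2 - t * (t + k * s + s * A)"
      unfolding k(1) by (simp add: algebra_simps power2_eq_square)
    then show "s * (s * C - t * A - x) = t ^ 2" using k(2) by simp
  next
    assume eq: "s * (s * C - t * A - x) = t ^ 2"
    then have s: "s \<noteq> 0" using False by auto
    \<comment> \<open>The solution of the equation between the coefficients of
      \<open>\<theta>\<close>; \<open>s = 0\<close> would give \<open>t = 0\<close>, which this case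
      excludes.\<close>
    let ?k = "- (t + s * A) / s"
    have "?k \<in> K" using str AC by (intro K_closed)
    moreover have "x = ?k * t + s * C" using eq s by (simp add: field_simps power2_eq_square)
    moreover have "0 = t + ?k * s + s * A" using s by (simp add: field_simps)
    ultimately show "\<exists>k\<in>K. x = k * t + s * C \<and> 0 = t + k * s + s * A" by blast
  qed
  finally show ?thesis using False g by simp
qed

lemma Pen_aff_theta_conic:
  assumes g: "g \<noteq> 0"
  shows "nondeg_conic_of q B (Pen (aff g (g * \<theta>)) \<inter> B)"
proof -
  obtain C A where AC: "C \<in> K" "A \<in> K" "\<theta> * \<theta> = C + A * \<theta>" by (rule repr_exists)
  define v' where "v' = vec 0 (1 / g)"
  define w' where "w' = vec 0 (\<theta> * (1 / g))"
  \<comment> \<open>The vectors are chosen so that the point with coordinates \<open>s\<close>,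
    \<open>t\<close>, \<open>r\<close> has \<open>\<eta> = (t + s * \<theta>) / g\<close> and
    \<open>x = s * C - t * A - r\<close>. The equation of \<open>conic_equation\<close> then reads
    \<open>s * r = t ^ 2\<close>.\<close>
  define a where "a = vadd w' (smul C u)"
  define b where "b = vadd v' (smul (- A) u)"
  define c where "c = smul (- 1) u"
  have lc_vec: "lc a b c s t r = vec (s * C - t * A - r) ((t + s * \<theta>) / g)"
    if "s \<in> K" "t \<in> K" "r \<in> K" for s t r
  proof -
    have "lc a b c s t r = vadd (smul (s * C - t * A - r) u) (vadd (smul t v') (smul s w'))"
      unfolding a_def b_def c_def by (cases u; cases v'; cases w') (simp add: algebra_simps)
    also have "vadd (smul t v') (smul s w') = vec (t * 0 + s * 0) (t * (1 / g) + s * (\<theta> * (1 / g)))"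
      unfolding v'_def w'_def by (rule vec_lin[symmetric, OF that(2,1)])
    also have "\<dots> = vec 0 ((t + s * \<theta>) / g)" by (simp add: add_divide_distrib)
    also have "vadd (smul (s * C - t * A - r) u) \<dots> = vec (s * C - t * A - r) ((t + s * \<theta>) / g)"
      using vec_lin[of "s * C - t * A - r" 1 1 0 0 "(t + s * \<theta>) / g"] vec_basis(1) that AC K_closed by simp
    finally show ?thesis .
  qed
  have det: "det3 a b c \<noteq> 0"
  proof
    assume 0: "det3 a b c = 0"
    \<comment> \<open>Passing from \<open>u\<close>, \<open>v'\<close>, \<open>w'\<close> to
      \<open>a\<close>, \<open>b\<close>, \<open>c\<close> has determinant 1. If the value were 0,
      \<open>cross3 u v'\<close> would vanish on a whole basis.\<close>
    have "det3 a b c = dot3 (cross3 u v') w'"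
      unfolding a_def b_def c_def by (cases u; cases v'; cases w') (simp add: algebra_simps)
    then have "cross3 u v' = (0, 0, 0)"
      using g 0 unfolding v'_def w'_def by (intro covector_vec[of _ "1 / g"]) (simp_all add: dot3_cross3)
    moreover have "v' \<noteq> (0, 0, 0)" using vec_nz g unfolding v'_def by simp
    ultimately have "pt u = pt v'" using cross3_eq_zero_iff u_nz by blast
    then show False using T_notin_LP g unfolding LP_def v'_def by fastforce
  qed
  \<comment> \<open>The substitution exchanging \<open>r\<close> and \<open>x\<close>. The condition
    \<open>Q\<close> is left abstract so that one statement serves both for \<open>B\<close>, with
    \<open>Q\<close> always true, and for the conic.\<close>
  have par: "(\<exists>s t r. s \<in> K \<and> t \<in> K \<and> r \<in> K \<and> (s, t, r) \<noteq> (0, 0, 0) \<and> R = pt (lc a b c s t r) \<and> Q s t r)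
      \<longleftrightarrow> (\<exists>x s t. x \<in> K \<and> s \<in> K \<and> t \<in> K \<and> (x, (t + s * \<theta>) / g) \<noteq> (0, 0) \<and>
        R = pt (vec x ((t + s * \<theta>) / g)) \<and> Q s t (s * C - t * A - x))" (is "?l \<longleftrightarrow> ?r") for R Q
  proof
    assume ?l
    then obtain s t r where *: "s \<in> K" "t \<in> K" "r \<in> K" "(s, t, r) \<noteq> (0, 0, 0)" "R = pt (lc a b c s t r)" "Q s t r"
      by blast
    let ?x = "s * C - t * A - r"
    have "?x \<in> K" using * AC by (intro K_closed)
    moreover have "(?x, (t + s * \<theta>) / g) \<noteq> (0, 0)" using *(4) repr_zero_iff[OF *(2,1)] g by auto
    moreover have "R = pt (vec ?x ((t + s * \<theta>) / g))" using * lc_vec by simp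
    moreover have "Q s t (s * C - t * A - ?x)" using * by simp
    ultimately show ?r using * by blast
  next
    assume ?r
    then obtain x s t where *: "x \<in> K" "s \<in> K" "t \<in> K" "(x, (t + s * \<theta>) / g) \<noteq> (0, 0)"
      "R = pt (vec x ((t + s * \<theta>) / g))" "Q s t (s * C - t * A - x)" by blast
    let ?r = "s * C - t * A - x"
    have "?r \<in> K" using * AC by (intro K_closed)
    moreover have "(s, t, ?r) \<noteq> (0, 0, 0)" using *(4) by auto
    moreover have "R = pt (lc a b c s t ?r)" using * lc_vec[OF *(2,3) \<open>?r \<in> K\<close>] by simp
    ultimately show ?l using * by blast
  qed
  have inB: "R \<in> B \<longleftrightarrow> (\<exists>x s t. x \<in> K \<and> s \<in> K \<and> t \<in> K \<and> (x, (t + s * \<theta>) / g) \<noteq> (0, 0) \<and>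
        R = pt (vec x ((t + s * \<theta>) / g)) \<and> True)" for R
  proof
    assume "R \<in> B"
    then obtain x \<eta> where x: "x \<in> K" "(x, \<eta>) \<noteq> (0, 0)" "R = pt (vec x \<eta>)" using mem_B_iff by blast
    have "\<eta> = (re (\<eta> * g) + im (\<eta> * g) * \<theta>) / g" using g by (simp add: re_im)
    then show "\<exists>x s t. x \<in> K \<and> s \<in> K \<and> t \<in> K \<and> (x, (t + s * \<theta>) / g) \<noteq> (0, 0) \<and>
        R = pt (vec x ((t + s * \<theta>) / g)) \<and> True"
      using x re_im by metis
  qed (use vec_in_B in blast)
  have inPen: "R \<in> Pen (aff g (g * \<theta>)) \<inter> B \<longleftrightarrow>
      (\<exists>x s t. x \<in> K \<and> s \<in> K \<and> t \<in> K \<and> (x, (t + s * \<theta>) / g) \<noteq> (0, 0) \<and>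
        R = pt (vec x ((t + s * \<theta>) / g)) \<and> s * (s * C - t * A - x) = t ^ 2)" (is "_ \<longleftrightarrow> ?r") for R
  proof -
    have Pen_iff: "pt (vec x ((t + s * \<theta>) / g)) \<in> Pen (aff g (g * \<theta>)) \<longleftrightarrow> s * (s * C - t * A - x) = t ^ 2"
      if "x \<in> K" "s \<in> K" "t \<in> K" "(x, (t + s * \<theta>) / g) \<noteq> (0, 0)" for x s t
      unfolding pt_vec_in_Pen[OF that(4)] by (rule conic_equation[OF AC(2,1,3) g that(2,3,1)])
    show ?thesis
    proof
      assume R: "R \<in> Pen (aff g (g * \<theta>)) \<inter> B"
      then obtain x s t where "x \<in> K" "s \<in> K" "t \<in> K" "(x, (t + s * \<theta>) / g) \<noteq> (0, 0)"
        "R = pt (vec x ((t + s * \<theta>) / g))" using inB[of R] by blast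
      moreover from this have "s * (s * C - t * A - x) = t ^ 2" using Pen_iff[of x s t] R by blast
      ultimately show ?r by blast
    next
      assume ?r
      then obtain x s t where "x \<in> K" "s \<in> K" "t \<in> K" "(x, (t + s * \<theta>) / g) \<noteq> (0, 0)"
        "R = pt (vec x ((t + s * \<theta>) / g))" "s * (s * C - t * A - x) = t ^ 2" by blast
      then show "R \<in> Pen (aff g (g * \<theta>)) \<inter> B"
        using Pen_iff[of x s t] vec_in_B[of x "(t + s * \<theta>) / g"] by blast
    qed
  qed
  have "B = {pt (lc a b c s t r) | s t r. s \<in> K \<and> t \<in> K \<and> r \<in> K \<and> (s, t, r) \<noteq> (0, 0, 0)}"
  proof (rule set_eqI)
    show "R \<in> B \<longleftrightarrow> R \<in> {pt (lc a b c s t r) | s t r. s \<in> K \<and> t \<in> K \<and> r \<in> K \<and> (s, t, r) \<noteq> (0, 0, 0)}" for R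
      unfolding inB[of R] par[of R "\<lambda>_ _ _. True", symmetric] by blast
  qed
  moreover have "Pen (aff g (g * \<theta>)) \<inter> B = {pt (lc a b c s t r) | s t r.
      s \<in> K \<and> t \<in> K \<and> r \<in> K \<and> (s, t, r) \<noteq> (0, 0, 0) \<and> s * r = t ^ 2}"
  proof (rule set_eqI)
    show "R \<in> Pen (aff g (g * \<theta>)) \<inter> B \<longleftrightarrow> R \<in> {pt (lc a b c s t r) | s t r.
        s \<in> K \<and> t \<in> K \<and> r \<in> K \<and> (s, t, r) \<noteq> (0, 0, 0) \<and> s * r = t ^ 2}" for R
      unfolding inPen[of R] par[of R "\<lambda>s t r. s * r = t ^ 2", symmetric] by blast
  qed
  ultimately show ?thesis
    unfolding nondeg_conic_of_def K_def[symmetric] using det by blast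
qed

end

section \<open>Separating and counting the two types\<close>

context baer_frame
begin

definition line_pair :: "'a vec3 set set \<Rightarrow> bool" where
  "line_pair S \<longleftrightarrow> (\<exists>L1 L2. b_line q B L1 \<and> (\<exists>m\<in>pg_lines. L1 \<subseteq> m \<and> P \<in> m)
     \<and> b_line q B L2 \<and> pt u \<in> L2 \<and> S = L1 \<union> L2)"

lemma LP_extends: "\<exists>m\<in>pg_lines. LP \<subseteq> m \<and> P \<in> m"
  using line_X P_in_line_X line_of_in_pg_lines[OF X_nz] by blast

lemma line_pair_Pen_aff_zero: "g \<noteq> 0 \<Longrightarrow> line_pair (Pen (aff g 0) \<inter> B)"
  unfolding line_pair_def
  using Pen_aff_zero[of g] b_line_LP LP_extends b_line_LT[of "1 / g"] T_in_LT[of "1 / g"]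
  by (intro exI[of _ LP] exI[of _ "LT (1 / g)"]) simp

text \<open>Uniqueness of the line of \<open>B\<close> through the vertex forces the first component
  of the pair to be \<open>LP\<close>.\<close>

lemma line_pair_superset: "line_pair S \<Longrightarrow> LP \<subseteq> S"
  unfolding line_pair_def using b_line_P_unique by blast

lemma not_line_pair_Pen_aff_theta:
  assumes "g \<noteq> 0"
  shows "\<not> line_pair (Pen (aff g (g * \<theta>)) \<inter> B)"
proof
  assume "line_pair (Pen (aff g (g * \<theta>)) \<inter> B)"
  then have "LP \<subseteq> Pen (aff g (g * \<theta>)) \<inter> B" by (rule line_pair_superset)
  then have "LP = {}" using Pen_aff_theta_LP[OF assms] by blast
  then show False using b_line_two[OF b_line_LP] by blast
qed

text \<open>A conic has at most \<open>q + 1\<close> points, too few to contain a line of the subplane and a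
  point off it.\<close>

lemma not_conic_Pen_aff_zero:
  assumes "g \<noteq> 0"
  shows "\<not> nondeg_conic_of q B (Pen (aff g 0) \<inter> B)"
proof
  assume "nondeg_conic_of q B (Pen (aff g 0) \<inter> B)"
  then have "card (LP \<union> LT (1 / g)) \<le> q + 1"
    using card_nondeg_conic Pen_aff_zero[OF assms] by simp
  moreover have "card (insert (pt u) LP) \<le> card (LP \<union> LT (1 / g))"
    using T_in_LT by (intro card_mono) auto
  moreover have "card (insert (pt u) LP) = q + 2"
    using T_notin_LP b_line_card[OF b_line_LP] by simp
  ultimately show False by simp
qed

lemma conic_pencil_iff:
  "linf_baer_pencil q linf P \<Pi> \<and> nondeg_conic_of q B (\<Pi> \<inter> B) \<and> pt u \<in> \<Pi> \<inter> B
    \<longleftrightarrow> (\<exists>g. g \<noteq> 0 \<and> \<Pi> = Pen (aff g (g * \<theta>)))"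
  using linf_baer_pencil_iff not_conic_Pen_aff_zero Pen_aff_theta_conic T_in_Pen T_in_B by (metis IntI)

lemma line_pair_pencil_iff:
  "linf_baer_pencil q linf P \<Pi> \<and> line_pair (\<Pi> \<inter> B) \<longleftrightarrow> (\<exists>g. g \<noteq> 0 \<and> \<Pi> = Pen (aff g 0))"
  using linf_baer_pencil_iff not_line_pair_Pen_aff_theta line_pair_Pen_aff_zero by metis

lemma card_conic_pencils:
  "card {\<Pi>. linf_baer_pencil q linf P \<Pi> \<and> nondeg_conic_of q B (\<Pi> \<inter> B) \<and> pt u \<in> \<Pi> \<inter> B} = q ^ 2 - 1"
proof -
  have "{\<Pi>. linf_baer_pencil q linf P \<Pi> \<and> nondeg_conic_of q B (\<Pi> \<inter> B) \<and> pt u \<in> \<Pi> \<inter> B}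
      = (\<lambda>g. Pen (aff g (g * \<theta>))) ` (UNIV - {0})"
    unfolding conic_pencil_iff by blast
  moreover have "inj_on (\<lambda>g. Pen (aff g (g * \<theta>))) (UNIV - {0})"
    using aff_theta_inj by (intro inj_onI) (simp add: Pen_inject)
  ultimately show ?thesis by (simp add: card_image card_Diff_singleton card_field)
qed

lemma card_line_pair_pencils: "card {\<Pi>. linf_baer_pencil q linf P \<Pi> \<and> line_pair (\<Pi> \<inter> B)} = q + 1"
proof -
  have "{\<Pi>. linf_baer_pencil q linf P \<Pi> \<and> line_pair (\<Pi> \<inter> B)} = Pen ` {aff g 0 | g. g \<noteq> 0}"
    unfolding line_pair_pencil_iff by blast
  moreover have "inj Pen" using Pen_inject by (auto intro: injI)
  ultimately show ?thesis using card_aff_zero by (simp add: card_image inj_on_subset)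
qed

lemma ex1_pencil_through:
  assumes L: "b_line q B L" "pt u \<in> L"
  shows "\<exists>!\<Pi>. linf_baer_pencil q linf P \<Pi> \<and>
    (\<exists>L1. b_line q B L1 \<and> (\<exists>m\<in>pg_lines. L1 \<subseteq> m \<and> P \<in> m) \<and> \<Pi> \<inter> B = L1 \<union> L)"
proof -
  obtain h where h: "h \<noteq> 0" "L = LT h" using b_line_T_cases[OF L] .
  show ?thesis
  proof (rule ex1I[of _ "Pen (aff (1 / h) 0)"])
    have "Pen (aff (1 / h) 0) \<inter> B = LP \<union> L" using Pen_aff_zero[of "1 / h"] h by simp
    moreover have "linf_baer_pencil q linf P (Pen (aff (1 / h) 0))"
      using linf_baer_pencilI h(1) by simp
    ultimately show "linf_baer_pencil q linf P (Pen (aff (1 / h) 0)) \<and>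
        (\<exists>L1. b_line q B L1 \<and> (\<exists>m\<in>pg_lines. L1 \<subseteq> m \<and> P \<in> m) \<and> Pen (aff (1 / h) 0) \<inter> B = L1 \<union> L)"
      using b_line_LP LP_extends by blast
  next
    fix \<Pi> assume *: "linf_baer_pencil q linf P \<Pi> \<and>
        (\<exists>L1. b_line q B L1 \<and> (\<exists>m\<in>pg_lines. L1 \<subseteq> m \<and> P \<in> m) \<and> \<Pi> \<inter> B = L1 \<union> L)"
    then have "line_pair (\<Pi> \<inter> B)" unfolding line_pair_def using L by blast
    then obtain g where g: "g \<noteq> 0" "\<Pi> = Pen (aff g 0)" using * line_pair_pencil_iff[of \<Pi>] by auto
    \<comment> \<open>A point of \<open>L\<close> off both \<open>LP\<close> and
      \<open>pt u\<close>: its membership in the pencil gives \<open>1 / h = g * k\<close> with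
      \<open>k\<close> in \<open>K\<close>, so both directions define the same line through
      0.\<close>
    have "pt (vec 1 (1 * h)) \<in> LT h"
      unfolding LT_def mem_Collect_eq by (intro exI[of _ 1] exI[of _ 1]) simp
    then have "pt (vec 1 h) \<in> Pen (aff g 0)" using * g h(2) by auto
    then have "1 / h \<in> aff g 0" using pt_vec_in_Pen[of 1 h] h(1) by simp
    then obtain k where k: "k \<in> K" "1 / h = g * k" by (auto simp: aff_def)
    then have "k \<noteq> 0" using h(1) by auto
    then show "\<Pi> = Pen (aff (1 / h) 0)" unfolding k(2) g(2) using aff_scale[OF k(1)] by simp
  qed
qed

lemma ex1_b_line_P: "\<exists>!L. b_line q B L \<and> (\<exists>m\<in>pg_lines. L \<subseteq> m \<and> P \<in> m)"
proof (rule ex1I[of _ LP])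
  show "b_line q B LP \<and> (\<exists>m\<in>pg_lines. LP \<subseteq> m \<and> P \<in> m)"
    using b_line_LP LP_extends by (rule conjI)
qed (elim conjE bexE, rule b_line_P_unique)

lemma pencil_cases:
  "linf_baer_pencil q linf P \<Pi> \<Longrightarrow>
    nondeg_conic_of q B (\<Pi> \<inter> B) \<and> pt u \<in> \<Pi> \<inter> B \<or> line_pair (\<Pi> \<inter> B)"
  using linf_baer_pencil_iff[of \<Pi>] conic_pencil_iff[of \<Pi>] line_pair_pencil_iff[of \<Pi>] by blast

end

theorem theorem2p8:
  fixes q :: nat
    and linf :: "('a::{field,finite}) vec3 set set"
    and B :: "'a vec3 set set"
    and T P :: "'a vec3 set"
  assumes "card (UNIV :: 'a set) = q ^ 2"
    and "linf \<in> pg_lines"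
    and "baer_subplane q B"
    and "linf \<inter> B = {T}"
    and "P \<in> linf" and "P \<noteq> T"
  shows "(\<forall>\<Pi>. linf_baer_pencil q linf P \<Pi> \<longrightarrow>
            (nondeg_conic_of q B (\<Pi> \<inter> B) \<and> T \<in> \<Pi> \<inter> B)
          \<or> (\<exists>L1 L2. b_line q B L1 \<and> (\<exists>m\<in>pg_lines. L1 \<subseteq> m \<and> P \<in> m)
                 \<and> b_line q B L2 \<and> T \<in> L2 \<and> \<Pi> \<inter> B = L1 \<union> L2))
    \<and> (\<exists>!L. b_line q B L \<and> (\<exists>m\<in>pg_lines. L \<subseteq> m \<and> P \<in> m))
    \<and> card {\<Pi>. linf_baer_pencil q linf P \<Pi> \<and> nondeg_conic_of q B (\<Pi> \<inter> B) \<and> T \<in> \<Pi> \<inter> B}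
        = q ^ 2 - 1
    \<and> card {\<Pi>. linf_baer_pencil q linf P \<Pi> \<and>
        (\<exists>L1 L2. b_line q B L1 \<and> (\<exists>m\<in>pg_lines. L1 \<subseteq> m \<and> P \<in> m)
                 \<and> b_line q B L2 \<and> T \<in> L2 \<and> \<Pi> \<inter> B = L1 \<union> L2)} = q + 1
    \<and> (\<forall>L. b_line q B L \<and> T \<in> L \<longrightarrow>
        (\<exists>!\<Pi>. linf_baer_pencil q linf P \<Pi> \<and>
          (\<exists>L1. b_line q B L1 \<and> (\<exists>m\<in>pg_lines. L1 \<subseteq> m \<and> P \<in> m) \<and> \<Pi> \<inter> B = L1 \<union> L)))"
proof -
  obtain \<theta> u v w E where frame: "baer_frame q (subq q) \<theta> B linf u v w E"
    and T: "T = pt u" and P: "P = pt (vadd w (smul (- \<theta>) v))"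
    using baer_frame_exists[OF assms] .
  interpret F: baer_frame q "subq q" \<theta> B linf u v w E by (fact frame)
  have P': "P = pt F.p0" unfolding P F.p0_def ..
  show ?thesis
    unfolding T P' F.line_pair_def[symmetric]
    using F.pencil_cases F.ex1_b_line_P F.card_conic_pencils F.card_line_pair_pencils
      F.ex1_pencil_through
    by (intro conjI allI impI) simp_all
qed

end
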